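(* Let $\mathcal{A}=C_c^\infty(F^+)\rtimes\Gamma$ be the groupoid action algebra in codimension $1$, $\mathcal{K}=U(g\ell_1)$, $V=S(g\ell_1^* )_{[2]}=\mathrm{span}\{1,R\}$, and define $\varphi_0,\varphi_1:V\otimes\mathcal{A}^{\otimes2}\to\mathbb{C}$ by $$\varphi_0((\alpha1+\beta R)\otimes a_0\otimes a_1)=\alpha\,\mathrm{tr}(a_0X(a_1)),\qquad\varphi_1((\alpha1+\beta R)\otimes a_0\otimes a_1)=\beta\,\mathrm{tr}(a_0\delta_1(a_1)).$$ Then the Hochschild cocycle $\varphi_0-\varphi_1$ is cyclic, i.e. $\tau(\varphi_0-\varphi_1)=-(\varphi_0-\varphi_1)$.
   Context: $\Gamma$ is a discrete subgroup of $\mathrm{Diff}^+(\mathbb{R})$; $F^+=\mathbb{R}\times\mathbb{R}_{>0}$ with coordinates $(x,y)$ and $\phi\in\Gamma$ acts by $\tilde\phi(x,y)=(\phi(x),\phi'(x)y)$. $\mathcal{A}=C_c^\infty(F^+)\rtimes\Gamma$ is spanned by symbols $fU_\phi^*$ with product $fU^*_\phi\cdot gU^*_\psi=f(g\circ\tilde\phi)U^*_{\psi\phi}$. The trace is $\mathrm{tr}(fU_\phi^* )=\int_{F^+}f\,y^{-2}dx\,dy$ if $\phi=\mathrm{Id}$ and $0$ otherwise (denoted $\tau$ in the paper; here $\tau$ is the cyclic operator). Operators on $\mathcal{A}$: $X(fU_\phi^* )=y\frac{\partial f}{\partial x}U_\phi^*$, $Y(fU_\phi^* )=y\frac{\partial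 f}{\partial y}U_\phi^*$, $\delta_1(fU_\phi^* )=y\frac{\phi''(x)}{\phi'(x)}fU_\phi^*$. $\mathcal{K}=U(g\ell_1)=\mathbb{C}[Y]$ with $Y$ primitive, acting on $\mathcal{A}$ by letting the generator $Y$ act as the operator $Y(fU_\phi^* )=y\frac{\partial f}{\partial y}U_\phi^*$ (and polynomials in $Y$ by composition). $V$ has basis $1,R$ ($R\in g\ell_1^*$ dual to $Y$, $R^2=0$), with (trivial) coadjoint action of $\mathcal{K}$ and left coaction $\nabla(1)=1\otimes1+Y\otimes R$, $\nabla(R)=1\otimes R$, written $v\mapsto v_{<-1>}\otimes v_{<0>}$. $C^q_{\mathcal K}(\mathcal A,V)$ consists of the $\mathcal K$-equivariant linear maps $V\otimes\mathcal A^{\otimes(q+1)}\to\mathbb{C}$. The Hochschild coboundary is $b=\sum_{i=0}^{q+1}(-1)^i\partial_i$, where for $0\le i\le q$ $\partial_i$ multiplies $a_ia_{i+1}$ and $(\partial_{q+1}\varphi)(v\otimes a_0\otimes\cdots\otimes a_{q+1})=\varphi(v_{<0>}\otimes(S^{-1}(v_{<-1>})a_{q+1})a_0\otimes a_1\otimes\cdots\otimes a_q)$. The cyclic operator is $(\tau\varphi)(v\otimes a_0\otimes\cdots\otimes a_q)=\varphi(v_{<0>}\otimes S^{-1}(v_{<-1>})a_q\otimes a_0\otimes\cdots\otimes a_{q-1})$. A $q$-cochain is cyclic if $\tau\varphi=(-1)^q\varphi$. *)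

theory Defs
  imports
    "HOL-Analysis.Analysis"
    "HOL-Computational_Algebra.Polynomial"
    "HOL-Algebra.Group"
begin

section \<open>The group of orientation preserving diffeomorphisms of the line\<close>

primrec higher_differentiable_on ::
    "'a::real_normed_vector set \<Rightarrow> ('a \<Rightarrow> 'b::real_normed_vector) \<Rightarrow> nat \<Rightarrow> bool" where
  "higher_differentiable_on S f 0 \<longleftrightarrow> continuous_on S f"
| "higher_differentiable_on S f (Suc n) \<longleftrightarrow>
     (\<forall>x\<in>S. f differentiable (at x)) \<and>
     (\<forall>v. higher_differentiable_on S (\<lambda>x. frechet_derivative f (at x) v) n)"

text \<open>Used for open \<open>S\<close> only.\<close>

definition smooth_on :: "'a::real_normed_vector set \<Rightarrow> ('a \<Rightarrow> 'b::real_normed_vector) \<Rightarrow> bool" where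
  "smooth_on S f \<longleftrightarrow> (\<forall>n. higher_differentiable_on S f n)"

definition Diff_plus :: "(real \<Rightarrow> real) monoid" where
  "Diff_plus =
     \<lparr>carrier = {\<phi>. bij \<phi> \<and> smooth_on UNIV \<phi> \<and> smooth_on UNIV (inv_into UNIV \<phi>)
                    \<and> (\<forall>x. deriv \<phi> x > 0)},
      mult = (\<circ>), one = id\<rparr>"

text \<open>The \<open>C\<^sup>\<infinity>\<close> topology: uniform convergence of all derivatives on compact sets.\<close>

definition Diff_plus_topology :: "(real \<Rightarrow> real) topology" where
  "Diff_plus_topology = topology_generated_by
     {{\<psi> \<in> carrier Diff_plus. \<forall>k\<le>n. \<forall>x\<in>{-r..r}. \<bar>(deriv ^^ k) \<psi> x - (deriv ^^ k) \<phi> x\<bar> < e}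
      | \<phi> n r e. \<phi> \<in> carrier Diff_plus \<and> e > 0}"

definition discrete_subgroup :: "(real \<Rightarrow> real) set \<Rightarrow> bool" where
  "discrete_subgroup \<Gamma> \<longleftrightarrow>
     subgroup \<Gamma> Diff_plus \<and> subtopology Diff_plus_topology \<Gamma> = discrete_topology \<Gamma>"


section \<open>The algebra \<open>C\<^sub>c\<^sup>\<infinity>(F\<^sup>+) \<rtimes> \<Gamma>\<close>\<close>

definition Fplus :: "(real \<times> real) set" where
  "Fplus = UNIV \<times> {0<..}"

definition lift :: "(real \<Rightarrow> real) \<Rightarrow> real \<times> real \<Rightarrow> real \<times> real" where
  "lift \<phi> = (\<lambda>(x, y). (\<phi> x, deriv \<phi> x * y))"

text \<open>Functions on \<open>F\<^sup>+\<close> are extended by zero to the plane.\<close>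

definition test_functions :: "(real \<times> real \<Rightarrow> complex) set" where
  "test_functions = {f. smooth_on Fplus f \<and> compact (closure {p. f p \<noteq> 0})
                        \<and> closure {p. f p \<noteq> 0} \<subseteq> Fplus}"

text \<open>An element \<open>\<Sum>\<^sub>\<phi> f\<^sub>\<phi> U\<^sub>\<phi>\<^sup>*\<close> is represented by the family \<open>\<phi> \<mapsto> f\<^sub>\<phi>\<close>.\<close>

type_synonym alg = "(real \<Rightarrow> real) \<Rightarrow> real \<times> real \<Rightarrow> complex"

definition supp :: "alg \<Rightarrow> (real \<Rightarrow> real) set" where
  "supp a = {\<phi>. a \<phi> \<noteq> (\<lambda>_. 0)}"

definition crossed_algebra :: "(real \<Rightarrow> real) set \<Rightarrow> alg set" where
  "crossed_algebra \<Gamma> = {a. finite (supp a) \<and> supp a \<subseteq> \<Gamma> \<and> range a \<subseteq> test_functions}"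

definition symb :: "(real \<times> real \<Rightarrow> complex) \<Rightarrow> (real \<Rightarrow> real) \<Rightarrow> alg" where
  "symb f \<phi> = (\<lambda>\<rho>. if \<rho> = \<phi> then f else (\<lambda>_. 0))"

definition alg_add :: "alg \<Rightarrow> alg \<Rightarrow> alg" where
  "alg_add a b = (\<lambda>\<phi> p. a \<phi> p + b \<phi> p)"

definition alg_scale :: "complex \<Rightarrow> alg \<Rightarrow> alg" where
  "alg_scale c a = (\<lambda>\<phi> p. c * a \<phi> p)"

definition alg_mult :: "alg \<Rightarrow> alg \<Rightarrow> alg" (infixl "\<star>" 70) where
  "a \<star> b = (\<lambda>\<rho> p. \<Sum>\<phi>\<in>supp a. \<Sum>\<psi>\<in>supp b. if \<psi> \<circ> \<phi> = \<rho> then a \<phi> p * b \<psi> (lift \<phi> p) else 0)"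

lemma symb_mult: "symb f \<phi> \<star> symb g \<psi> = symb (\<lambda>p. f p * g (lift \<phi> p)) (\<psi> \<circ> \<phi>)"
proof -
  have s: "supp (symb h \<rho>) = (if h = (\<lambda>_. 0) then {} else {\<rho>})" for h \<rho>
    by (auto simp: supp_def symb_def)
  show ?thesis
    unfolding alg_mult_def s
    by (cases "f = (\<lambda>_. 0)"; cases "g = (\<lambda>_. 0)"; rule ext; rule ext) (auto simp: symb_def)
qed

definition tr :: "alg \<Rightarrow> complex" where
  "tr a = (LINT p:Fplus|lborel. a id p / of_real ((snd p)\<^sup>2))"

definition opX :: "alg \<Rightarrow> alg" where
  "opX a = (\<lambda>\<phi> (x, y). of_real y * vector_derivative (\<lambda>s. a \<phi> (s, y)) (at x))"

definition opY :: "alg \<Rightarrow> alg" where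
  "opY a = (\<lambda>\<phi> (x, y). of_real y * vector_derivative (\<lambda>s. a \<phi> (x, s)) (at y))"

definition delta1 :: "alg \<Rightarrow> alg" where
  "delta1 a = (\<lambda>\<phi> (x, y). of_real (y * (deriv (deriv \<phi>) x / deriv \<phi> x)) * a \<phi> (x, y))"


section \<open>The Hopf algebra \<open>U(gl\<^sub>1) = \<complex>[Y]\<close> and the module-comodule \<open>V\<close>\<close>

definition counit :: "complex poly \<Rightarrow> complex" where
  "counit k = poly k 0"

definition antipode :: "complex poly \<Rightarrow> complex poly" where
  "antipode k = pcompose k [:0, -1:]"

text \<open>Elements of a tensor product are given as lists of simple tensors.
  As \<open>Y\<close> is primitive, \<open>\<Delta>(Y\<^sup>n) = (Y \<otimes> 1 + 1 \<otimes> Y)\<^sup>n\<close>.\<close>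

definition coproduct :: "complex poly \<Rightarrow> (complex poly \<times> complex poly) list" where
  "coproduct k = concat (map (\<lambda>n. map (\<lambda>i. (monom (coeff k n * of_nat (n choose i)) i, monom 1 (n - i)))
                                  [0..<Suc n]) [0..<Suc (degree k)])"

definition act :: "complex poly \<Rightarrow> alg \<Rightarrow> alg" where
  "act k a = (\<lambda>\<phi> p. \<Sum>n\<le>degree k. coeff k n * (opY ^^ n) a \<phi> p)"

text \<open>The pair \<open>(\<alpha>, \<beta>)\<close> stands for \<open>\<alpha> 1 + \<beta> R\<close>.\<close>

type_synonym V = "complex \<times> complex"

definition V_scale :: "complex \<Rightarrow> V \<Rightarrow> V" where
  "V_scale c = (\<lambda>(\<alpha>, \<beta>). (c * \<alpha>, c * \<beta>))"

definition coadjoint :: "complex poly \<Rightarrow> V \<Rightarrow> V" where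
  "coadjoint k v = V_scale (counit k) v"

definition coaction :: "V \<Rightarrow> (complex poly \<times> V) list" where
  "coaction = (\<lambda>(\<alpha>, \<beta>). [(1, (\<alpha>, \<beta>)), ([:0, 1:], (0, \<alpha>))])"


section \<open>Hopf-cyclic cochains\<close>

text \<open>A linear map \<open>V \<otimes> A\<^bsup>\<otimes>(q+1)\<^esup> \<rightarrow> \<complex>\<close> is given by the corresponding multilinear map, whose
  second argument is the list of the \<open>q + 1\<close> arguments in \<open>A\<close>. Values on other lists are irrelevant.\<close>

type_synonym cochain = "V \<Rightarrow> alg list \<Rightarrow> complex"

definition alg_tuples :: "(real \<Rightarrow> real) set \<Rightarrow> nat \<Rightarrow> alg list set" where
  "alg_tuples \<Gamma> q = {as. length as = q + 1 \<and> set as \<subseteq> crossed_algebra \<Gamma>}"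

definition multilinear :: "(real \<Rightarrow> real) set \<Rightarrow> nat \<Rightarrow> cochain \<Rightarrow> bool" where
  "multilinear \<Gamma> q \<Phi> \<longleftrightarrow> (\<forall>as\<in>alg_tuples \<Gamma> q.
     (\<forall>v w. \<Phi> (v + w) as = \<Phi> v as + \<Phi> w as) \<and>
     (\<forall>c v. \<Phi> (V_scale c v) as = c * \<Phi> v as) \<and>
     (\<forall>v. \<forall>i\<le>q. \<forall>a\<in>crossed_algebra \<Gamma>.
        (\<forall>b\<in>crossed_algebra \<Gamma>. \<Phi> v (as[i := alg_add a b]) = \<Phi> v (as[i := a]) + \<Phi> v (as[i := b])) \<and>
        (\<forall>c. \<Phi> v (as[i := alg_scale c a]) = c * \<Phi> v (as[i := a]))))"

text \<open>\<open>diag_eval k [a\<^sub>0, \<dots>, a\<^sub>q] G\<close> is \<open>G(k\<^bsub>(1)\<^esub> a\<^sub>0 \<otimes> \<dots> \<otimes> k\<^bsub>(q+1)\<^esub> a\<^sub>q)\<close>.\<close>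

fun diag_eval :: "complex poly \<Rightarrow> alg list \<Rightarrow> (alg list \<Rightarrow> complex) \<Rightarrow> complex" where
  "diag_eval k [] G = counit k * G []"
| "diag_eval k (a # as) G = (\<Sum>(k1, k2)\<leftarrow>coproduct k. diag_eval k2 as (\<lambda>bs. G (act k1 a # bs)))"

text \<open>\<open>\<complex>\<close> carries the trivial action through the counit.\<close>

definition equivariant :: "(real \<Rightarrow> real) set \<Rightarrow> nat \<Rightarrow> cochain \<Rightarrow> bool" where
  "equivariant \<Gamma> q \<Phi> \<longleftrightarrow> (\<forall>k v. \<forall>as\<in>alg_tuples \<Gamma> q.
     (\<Sum>(k1, k2)\<leftarrow>coproduct k. diag_eval k2 as (\<Phi> (coadjoint k1 v))) = counit k * \<Phi> v as)"

definition cochains :: "(real \<Rightarrow> real) set \<Rightarrow> nat \<Rightarrow> cochain set" where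
  "cochains \<Gamma> q = {\<Phi>. multilinear \<Gamma> q \<Phi> \<and> equivariant \<Gamma> q \<Phi>}"

definition face :: "nat \<Rightarrow> nat \<Rightarrow> cochain \<Rightarrow> cochain" where
  "face q i \<Phi> = (\<lambda>v as.
     if i \<le> q then \<Phi> v (take i as @ [as ! i \<star> as ! (i + 1)] @ drop (i + 2) as)
     else (\<Sum>(k, w)\<leftarrow>coaction v.
             \<Phi> w ((act (inv_into UNIV antipode k) (last as) \<star> hd as) # tl (butlast as))))"

definition hochschild_b :: "nat \<Rightarrow> cochain \<Rightarrow> cochain" where
  "hochschild_b q \<Phi> = (\<lambda>v as. \<Sum>i\<le>q + 1. (-1) ^ i * face q i \<Phi> v as)"

definition cyclic_op :: "cochain \<Rightarrow> cochain" where
  "cyclic_op \<Phi> = (\<lambda>v as. \<Sum>(k, w)\<leftarrow>coaction v.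
     \<Phi> w (act (inv_into UNIV antipode k) (last as) # butlast as))"

definition hochschild_cocycle :: "(real \<Rightarrow> real) set \<Rightarrow> nat \<Rightarrow> cochain \<Rightarrow> bool" where
  "hochschild_cocycle \<Gamma> q \<Phi> \<longleftrightarrow>
     \<Phi> \<in> cochains \<Gamma> q \<and> (\<forall>v. \<forall>as\<in>alg_tuples \<Gamma> (q + 1). hochschild_b q \<Phi> v as = 0)"

definition cyclic :: "(real \<Rightarrow> real) set \<Rightarrow> nat \<Rightarrow> cochain \<Rightarrow> bool" where
  "cyclic \<Gamma> q \<Phi> \<longleftrightarrow> (\<forall>v. \<forall>as\<in>alg_tuples \<Gamma> q. cyclic_op \<Phi> v as = (-1) ^ q * \<Phi> v as)"

definition phi0 :: cochain where
  "phi0 = (\<lambda>(\<alpha>, \<beta>) as. \<alpha> * tr (as ! 0 \<star> opX (as ! 1)))"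

definition phi1 :: cochain where
  "phi1 = (\<lambda>(\<alpha>, \<beta>) as. \<beta> * tr (as ! 0 \<star> delta1 (as ! 1)))"

end

theory Submission
  imports Defs
begin

text \<open>
  The operators \<open>Y\<close> and \<open>\<delta>\<^sub>1\<close> are derivations of the crossed product, whereas
  \<open>X(ab) = X(a) b + a X(b) + \<delta>\<^sub>1(a) Y(b)\<close>. The trace satisfies \<open>tr \<circ> X = 0\<close>, \<open>tr \<circ> \<delta>\<^sub>1 = 0\<close> and
  \<open>tr \<circ> Y = tr\<close>, and it is tracial because \<open>y\<^bsup>-2\<^esup> dx dy\<close> is invariant under \<open>\<Gamma>\<close>. Applying the
  trace to the three Leibniz rules gives the cocycle identity and cyclicity: the defect term
  \<open>tr(\<delta>\<^sub>1(a) Y(b))\<close> of \<open>X\<close> is what the coaction \<open>1 \<mapsto> 1 \<otimes> 1 + Y \<otimes> R\<close> contributes. Equivariance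
  follows from \<open>[Y, X] = X\<close> and \<open>[Y, \<delta>\<^sub>1] = \<delta>\<^sub>1\<close>, which cancel the weight of the trace under \<open>Y\<close>.
\<close>

subsection \<open>Smooth functions\<close>

text \<open>The obstacle is regularity. Smoothness of the coefficients of \<open>a \<star> b\<close>
  or \<open>delta1 a\<close> would call for the calculus of compositions and quotients at every
  order, while the trace identities ask for much less. So smoothness is recorded for
  \<open>crossed_algebra\<close>, which X and Y preserve, whereas products and images of
  \<open>delta1\<close> are followed in the larger \<open>Cc_algebra\<close> (continuous
  coefficients with compact support in the open half plane), together with differentiability of
  first order. That X or Y of a product stays there is read off from its Leibniz rule, each summand
  of which lies there. The trace identities for X and Y are integrations by parts: y^-2 X(f) = d/dx
  (f / y) and y^-2 (Y(f) - f) = d/dy (f / y). The same exponent -2 cancels the Jacobian \<phi>'^2 of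
  the lift of \<phi>, which gives traciality.\<close>

lemma frechet_derivative_at_eq: "(f has_derivative f') (at x) \<Longrightarrow> frechet_derivative f (at x) = f'"
  using frechet_derivative_at by metis

lemma differentiable_has_derivative:
  "f differentiable (at x) \<Longrightarrow> (f has_derivative frechet_derivative f (at x)) (at x)"
  using frechet_derivative_works by blast

lemma higher_differentiable_on_cong:
  assumes "open S" "\<And>x. x \<in> S \<Longrightarrow> f x = g x" "higher_differentiable_on S f n"
  shows "higher_differentiable_on S g n"
  using assms(2,3)
proof (induction n arbitrary: f g)
  case 0
  then show ?case
    by (simp add: continuous_on_eq)
next
  case (Suc n)
  have D: "(g has_derivative frechet_derivative f (at x)) (at x)" if "x \<in> S" for x
    using has_derivative_transform_within_open[OF differentiable_has_derivative assms(1) that]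
      Suc.prems that by auto
  then have eq: "frechet_derivative g (at x) = frechet_derivative f (at x)" if "x \<in> S" for x
    using that frechet_derivative_at_eq by blast
  have "higher_differentiable_on S (\<lambda>x. frechet_derivative g (at x) v) n" for v
    by (rule Suc.IH[of "\<lambda>x. frechet_derivative f (at x) v"]) (use Suc.prems eq in auto)
  moreover have "g differentiable (at x)" if "x \<in> S" for x
    using D[OF that] differentiable_def by blast
  ultimately show ?case
    by simp
qed

lemma higher_differentiable_on_lower:
  "higher_differentiable_on S f (Suc n) \<Longrightarrow> higher_differentiable_on S f n"
proof (induction n arbitrary: f)
  case 0
  then show ?case
    by (auto intro!: continuous_at_imp_continuous_on differentiable_imp_continuous_within)
next
  case (Suc n)
  then show ?case
    by (metis higher_differentiable_on.simps(2))
qed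

text \<open>Differentiability at a point is local already; only continuity at order 0 has to be
  glued, and there openness enters. Applied to \<open>Fplus\<close> and the complement of a support,
  this makes extension by zero smooth.\<close>

lemma higher_differentiable_on_Un:
  assumes "open S" "open T" "higher_differentiable_on S f n" "higher_differentiable_on T f n"
  shows "higher_differentiable_on (S \<union> T) f n"
  using assms(3,4) by (induction n arbitrary: f) (auto intro: continuous_on_open_Un assms(1,2))

lemma higher_differentiable_on_subset:
  "higher_differentiable_on T f n \<Longrightarrow> S \<subseteq> T \<Longrightarrow> higher_differentiable_on S f n"
  by (induction n arbitrary: f) (auto intro: continuous_on_subset)

lemma higher_differentiable_on_const: "higher_differentiable_on S (\<lambda>_. c) n"
  by (induction n arbitrary: c) auto

lemma higher_differentiable_on_bounded_linear:
  assumes "bounded_linear f"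
  shows "higher_differentiable_on S f n"
proof (cases n)
  case 0
  then show ?thesis
    by (simp add: assms linear_continuous_on)
next
  case (Suc m)
  have "(f has_derivative f) (at x)" for x
    by (rule bounded_linear_imp_has_derivative[OF assms])
  then have "frechet_derivative f (at x) = f" "f differentiable (at x)" for x
    using frechet_derivative_at_eq differentiable_def by blast+
  then show ?thesis
    by (simp add: Suc higher_differentiable_on_const)
qed

lemma higher_differentiable_on_add:
  assumes "open S" "higher_differentiable_on S f n" "higher_differentiable_on S g n"
  shows "higher_differentiable_on S (\<lambda>x. f x + g x) n"
  using assms(2,3)
proof (induction n arbitrary: f g)
  case 0
  then show ?case
    by (auto intro: continuous_intros)
next
  case (Suc n)
  have D: "((\<lambda>x. f x + g x) has_derivative
      (\<lambda>v. frechet_derivative f (at x) v + frechet_derivative g (at x) v)) (at x)" if "x \<in> S" for x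
    by (intro has_derivative_add differentiable_has_derivative) (use Suc.prems that in auto)
  have "higher_differentiable_on S
      (\<lambda>x. frechet_derivative f (at x) v + frechet_derivative g (at x) v) n" for v
    by (rule Suc.IH) (use Suc.prems in auto)
  then have "higher_differentiable_on S (\<lambda>x. frechet_derivative (\<lambda>x. f x + g x) (at x) v) n" for v
    by (rule higher_differentiable_on_cong[OF assms(1), rotated]) (simp add: frechet_derivative_at_eq[OF D])
  then show ?case
    using D by (auto simp: differentiable_def)
qed

lemma (in bounded_bilinear) higher_differentiable_on_prod:
  assumes "open S" "higher_differentiable_on S f n" "higher_differentiable_on S g n"
  shows "higher_differentiable_on S (\<lambda>x. prod (f x) (g x)) n"
  using assms(2,3)
proof (induction n arbitrary: f g)
  case 0
  then show ?case
    by (auto intro: continuous_on)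
next
  case (Suc n)
  have D: "((\<lambda>x. prod (f x) (g x)) has_derivative
      (\<lambda>v. prod (f x) (frechet_derivative g (at x) v) + prod (frechet_derivative f (at x) v) (g x))) (at x)"
    if "x \<in> S" for x
    using Suc.prems that by (intro FDERIV differentiable_has_derivative) auto
  \<comment> \<open>The product rule retains the undifferentiated factors, so the induction
    hypothesis is applied to them at order n as well.\<close>
  have low: "higher_differentiable_on S f n" "higher_differentiable_on S g n"
    using Suc.prems by (blast intro: higher_differentiable_on_lower)+
  have "higher_differentiable_on S
      (\<lambda>x. prod (f x) (frechet_derivative g (at x) v) + prod (frechet_derivative f (at x) v) (g x)) n" for v
    by (intro higher_differentiable_on_add[OF assms(1)] Suc.IH low) (use Suc.prems in auto)
  then have "higher_differentiable_on S (\<lambda>x. frechet_derivative (\<lambda>x. prod (f x) (g x)) (at x) v) n" for v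
    by (rule higher_differentiable_on_cong[OF assms(1), rotated]) (simp add: frechet_derivative_at_eq[OF D])
  then show ?case
    using D by (auto simp: differentiable_def)
qed

lemma smooth_on_differentiable: "smooth_on S f \<Longrightarrow> x \<in> S \<Longrightarrow> f differentiable (at x)"
  unfolding smooth_on_def by (drule spec[of _ "Suc 0"]) simp

lemma smooth_on_continuous: "smooth_on S f \<Longrightarrow> continuous_on S f"
  unfolding smooth_on_def by (drule spec[of _ 0]) simp

lemma smooth_on_frechet_derivative:
  "smooth_on S f \<Longrightarrow> smooth_on S (\<lambda>x. frechet_derivative f (at x) v)"
  unfolding smooth_on_def by (metis higher_differentiable_on.simps(2))

lemma smooth_on_scaleR:
  "open S \<Longrightarrow> smooth_on S f \<Longrightarrow> smooth_on S g \<Longrightarrow> smooth_on S (\<lambda>x. f x *\<^sub>R g x)"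
  unfolding smooth_on_def by (blast intro: bounded_bilinear.higher_differentiable_on_prod[OF bounded_bilinear_scaleR])

lemma smooth_on_mult_left:
  fixes f :: "'a::real_normed_vector \<Rightarrow> complex"
  shows "open S \<Longrightarrow> smooth_on S f \<Longrightarrow> smooth_on S (\<lambda>x. c * f x)"
  unfolding smooth_on_def
  using bounded_bilinear.higher_differentiable_on_prod[OF bounded_bilinear_mult]
    higher_differentiable_on_const by blast

lemma smooth_on_bounded_linear: "bounded_linear f \<Longrightarrow> smooth_on S f"
  unfolding smooth_on_def by (blast intro: higher_differentiable_on_bounded_linear)

lemma smooth_on_deriv:
  fixes f :: "real \<Rightarrow> real"
  assumes "smooth_on UNIV f"
  shows "smooth_on UNIV (deriv f)"
proof -
  have "frechet_derivative f (at x) 1 = deriv f x" for x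
  proof -
    have "(f has_real_derivative deriv f x) (at x)"
      using smooth_on_differentiable[OF assms, of x]
      by (simp add: DERIV_deriv_iff_real_differentiable)
    then show ?thesis
      by (simp add: frechet_derivative_at_eq has_field_derivative_def)
  qed
  then show ?thesis
    using smooth_on_frechet_derivative[OF assms, of 1] by simp
qed

lemma smooth_on_has_real_derivative:
  fixes f :: "real \<Rightarrow> real"
  shows "smooth_on UNIV f \<Longrightarrow> (f has_real_derivative deriv f x) (at x)"
  using smooth_on_differentiable[of UNIV f x] by (simp add: DERIV_deriv_iff_real_differentiable)

text \<open>Bridge between derivatives along lines, in which \<open>opX\<close> is written, and
  Frechet derivatives, in which smoothness is written. The next lemma does the same for
  \<open>opY\<close>.\<close>

lemma partial_fst_has_vector_derivative:
  fixes f :: "real \<times> real \<Rightarrow> 'a::real_normed_vector"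
  assumes "f differentiable (at (x, y))"
  shows "((\<lambda>s. f (s, y)) has_vector_derivative frechet_derivative f (at (x, y)) (1, 0)) (at x)"
proof -
  have D: "(f has_derivative frechet_derivative f (at (x, y))) (at (x, y))"
    by (rule differentiable_has_derivative[OF assms])
  have "((\<lambda>s. (s, y)) has_derivative (\<lambda>h. (h, 0))) (at x)"
    by (rule has_derivative_Pair[OF has_derivative_ident has_derivative_const])
  from has_derivative_compose[OF this D]
  have "((\<lambda>s. f (s, y)) has_derivative (\<lambda>h. frechet_derivative f (at (x, y)) (h, 0))) (at x)" .
  moreover have "(\<lambda>h. frechet_derivative f (at (x, y)) (h, 0)) = (\<lambda>h. h *\<^sub>R frechet_derivative f (at (x, y)) (1, 0))"
  proof
    show "frechet_derivative f (at (x, y)) (h, 0) = h *\<^sub>R frechet_derivative f (at (x, y)) (1, 0)" for h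
      using linear_scale[OF has_derivative_linear[OF D], of h "(1, 0)"]
      by (simp only: scaleR_Pair real_scaleR_def mult_1_right mult_zero_right)
  qed
  ultimately show ?thesis
    by (simp only: has_vector_derivative_def)
qed

lemma partial_snd_has_vector_derivative:
  fixes f :: "real \<times> real \<Rightarrow> 'a::real_normed_vector"
  assumes "f differentiable (at (x, y))"
  shows "((\<lambda>s. f (x, s)) has_vector_derivative frechet_derivative f (at (x, y)) (0, 1)) (at y)"
proof -
  have D: "(f has_derivative frechet_derivative f (at (x, y))) (at (x, y))"
    by (rule differentiable_has_derivative[OF assms])
  have "((\<lambda>s. (x, s)) has_derivative (\<lambda>h. (0, h))) (at y)"
    by (rule has_derivative_Pair[OF has_derivative_const has_derivative_ident])
  from has_derivative_compose[OF this D]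
  have "((\<lambda>s. f (x, s)) has_derivative (\<lambda>h. frechet_derivative f (at (x, y)) (0, h))) (at y)" .
  moreover have "(\<lambda>h. frechet_derivative f (at (x, y)) (0, h)) = (\<lambda>h. h *\<^sub>R frechet_derivative f (at (x, y)) (0, 1))"
  proof
    show "frechet_derivative f (at (x, y)) (0, h) = h *\<^sub>R frechet_derivative f (at (x, y)) (0, 1)" for h
      using linear_scale[OF has_derivative_linear[OF D], of h "(0, 1)"]
      by (simp only: scaleR_Pair real_scaleR_def mult_1_right mult_zero_right)
  qed
  ultimately show ?thesis
    by (simp only: has_vector_derivative_def)
qed

text \<open>Differentiate \<open>f(x, t) = f(x, c) + \<integral>\<^bsub>c\<^esub>\<^bsup>t\<^esup> \<partial>\<^sub>y f(x, s) ds\<close> in \<open>x\<close> under the integral sign, then in \<open>t\<close>.\<close>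

lemma mixed_partials_eq:
  fixes f :: "real \<times> real \<Rightarrow> 'a::banach"
  assumes "smooth_on UNIV f"
  defines "fx \<equiv> \<lambda>p. frechet_derivative f (at p) (1, 0)"
  defines "fy \<equiv> \<lambda>p. frechet_derivative f (at p) (0, 1)"
  shows "frechet_derivative fx (at p) (0, 1) = frechet_derivative fy (at p) (1, 0)"
proof -
  obtain x y where p: "p = (x, y)"
    by (cases p)
  \<comment> \<open>A base point strictly below y: then y is interior to {c..y + 1}, and the
    derivative of the integral within that interval is a two-sided one.\<close>
  define c where "c = y - 1"
  have smooth: "smooth_on UNIV fx" "smooth_on UNIV fy"
    unfolding fx_def fy_def by (intro smooth_on_frechet_derivative assms)+
  define fxy where "fxy = (\<lambda>p. frechet_derivative fy (at p) (1, 0))"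
  have "smooth_on UNIV fxy"
    unfolding fxy_def by (intro smooth_on_frechet_derivative smooth)
  then have cont: "continuous_on UNIV fxy" "continuous_on UNIV fy"
    using smooth by (auto intro: smooth_on_continuous)
  have contp: "continuous_on S (\<lambda>s. fxy (x, s))" "continuous_on S (\<lambda>s. fy (u, s))" for S u
    using continuous_on_compose2[OF cont(1), of S "\<lambda>s. (x, s)"]
      continuous_on_compose2[OF cont(2), of S "\<lambda>s. (u, s)"]
    by (simp_all add: continuous_on_Pair)
  have fx_eq: "fx (x, t) = fx (x, c) + integral {c..t} (\<lambda>s. fxy (x, s))" if "c \<le> t" for t
  proof -
    have f_eq: "(\<lambda>u. f (u, c) + integral (cbox c t) (\<lambda>s. fy (u, s))) = (\<lambda>u. f (u, t))"
    proof
      fix u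
      have "((\<lambda>s. fy (u, s)) has_integral f (u, t) - f (u, c)) {c..t}"
        unfolding fy_def
        by (intro fundamental_theorem_of_calculus that has_vector_derivative_at_within[OF
            partial_snd_has_vector_derivative[OF smooth_on_differentiable[OF assms(1) UNIV_I]]])
      then show "f (u, c) + integral (cbox c t) (\<lambda>s. fy (u, s)) = f (u, t)"
        by (simp add: integral_unique)
    qed
    have d1: "((\<lambda>u. f (u, c) + integral (cbox c t) (\<lambda>s. fy (u, s))) has_vector_derivative
        fx (x, c) + integral (cbox c t) (\<lambda>s. fxy (x, s))) (at x)"
    proof (intro has_vector_derivative_add)
      show "((\<lambda>u. f (u, c)) has_vector_derivative fx (x, c)) (at x)"
        unfolding fx_def
        by (intro partial_fst_has_vector_derivative smooth_on_differentiable[OF assms(1)] UNIV_I)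
      show "((\<lambda>u. integral (cbox c t) (\<lambda>s. fy (u, s))) has_vector_derivative
        integral (cbox c t) (\<lambda>s. fxy (x, s))) (at x)"
      proof (rule leibniz_rule_vector_derivative[where U = UNIV])
        show "((\<lambda>x. fy (x, t)) has_vector_derivative fxy (x, t)) (at x)" for x t
          unfolding fxy_def
          by (intro partial_fst_has_vector_derivative smooth_on_differentiable[OF smooth(2)] UNIV_I)
        show "(\<lambda>s. fy (x, s)) integrable_on cbox c t" for x
          by (intro integrable_continuous contp)
        show "continuous_on (UNIV \<times> cbox c t) (\<lambda>(x, t). fxy (x, t))"
          using continuous_on_subset[OF cont(1)] by (simp add: case_prod_eta)
      qed auto
    qed
    have d2: "((\<lambda>u. f (u, t)) has_vector_derivative fx (x, t)) (at x)"
      unfolding fx_def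
      by (intro partial_fst_has_vector_derivative smooth_on_differentiable[OF assms(1)] UNIV_I)
    show ?thesis
      using vector_derivative_unique_at[OF d2 d1[unfolded f_eq]] by simp
  qed
  have "((\<lambda>t. integral {c..t} (\<lambda>s. fxy (x, s))) has_vector_derivative fxy (x, y)) (at y within {c..y + 1})"
    by (rule integral_has_vector_derivative[OF contp(1)]) (simp add: c_def)
  then have "((\<lambda>t. integral {c..t} (\<lambda>s. fxy (x, s))) has_vector_derivative fxy (x, y)) (at y)"
    using at_within_interior[of y "{c..y + 1}"] by (simp add: c_def)
  then have "((\<lambda>t. fx (x, c) + integral {c..t} (\<lambda>s. fxy (x, s))) has_vector_derivative fxy (x, y)) (at y)"
    using has_vector_derivative_add[OF has_vector_derivative_const] by fastforce
  then have "((\<lambda>t. fx (x, t)) has_vector_derivative fxy (x, y)) (at y)"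
  proof (rule has_vector_derivative_transform_within_open)
    show "fx (x, c) + integral {c..t} (\<lambda>s. fxy (x, s)) = fx (x, t)" if "t \<in> {c<..}" for t
      by (rule fx_eq[symmetric]) (use that in simp)
  qed (simp_all add: c_def)
  moreover have "((\<lambda>t. fx (x, t)) has_vector_derivative frechet_derivative fx (at p) (0, 1)) (at y)"
    unfolding p by (intro partial_snd_has_vector_derivative smooth_on_differentiable[OF smooth(1)] UNIV_I)
  ultimately have "fxy (x, y) = frechet_derivative fx (at p) (0, 1)"
    by (rule vector_derivative_unique_at)
  then show ?thesis
    by (simp add: fxy_def p)
qed


subsection \<open>Integration\<close>

lemma integrable_compact_support:
  fixes g :: "'a::euclidean_space \<Rightarrow> 'b::{banach, second_countable_topology}"
  assumes "continuous_on UNIV g" "compact K" "\<And>p. p \<notin> K \<Longrightarrow> g p = 0"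
  shows "integrable lborel g"
proof -
  have "integrable lborel (\<lambda>x. indicator K x *\<^sub>R g x)"
    by (intro borel_integrable_compact assms continuous_on_subset[OF assms(1)]) simp
  moreover have "(\<lambda>x. indicator K x *\<^sub>R g x) = g"
    using assms(3) by (auto simp: indicator_def fun_eq_iff)
  ultimately show ?thesis
    by simp
qed

text \<open>The fundamental theorem on an interval at whose ends F vanishes. \<open>tr_opX\<close>
  and \<open>tr_opY\<close> reduce to it on horizontal and vertical lines.\<close>

lemma integral_derivative_compact_support:
  fixes F :: "real \<Rightarrow> 'a::euclidean_space"
  assumes "\<And>s. (F has_vector_derivative F' s) (at s)" "continuous_on UNIV F'"
    and "\<And>s. \<bar>s\<bar> \<ge> r \<Longrightarrow> F s = 0" "\<And>s. \<bar>s\<bar> \<ge> r \<Longrightarrow> F' s = 0"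
  shows "integral\<^sup>L lborel F' = 0"
proof -
  define R where "R = \<bar>r\<bar>"
  have "(\<lambda>s. indicator {-R..R} s *\<^sub>R F' s) = F'"
  proof
    show "indicator {-R..R} s *\<^sub>R F' s = F' s" for s
      using assms(4)[of s] by (cases "s \<in> {-R..R}") (auto simp: R_def)
  qed
  moreover have "integral\<^sup>L lborel (\<lambda>s. indicator {-R..R} s *\<^sub>R F' s) = F R - F (-R)"
    by (intro integral_FTC_atLeastAtMost has_vector_derivative_at_within[OF assms(1)]
        continuous_on_subset[OF assms(2)]) (auto simp: R_def)
  ultimately show ?thesis
    using assms(3)[of R] assms(3)[of "-R"] by (simp add: R_def)
qed

lemma lborel_integral_fst:
  fixes g :: "real \<times> real \<Rightarrow> 'a::{banach, second_countable_topology}"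
  assumes "integrable lborel g"
  shows "integrable lborel (\<lambda>x. LINT y|lborel. g (x, y))"
    and "integral\<^sup>L lborel g = (LINT x|lborel. LINT y|lborel. g (x, y))"
  using lborel_pair.integrable_fst'[of g, unfolded lborel_prod, OF assms]
    lborel_pair.integral_fst'[of g, unfolded lborel_prod, OF assms] by simp_all

lemma lborel_integral_snd:
  fixes g :: "real \<times> real \<Rightarrow> 'a::{banach, second_countable_topology}"
  assumes "integrable lborel g"
  shows "integral\<^sup>L lborel g = (LINT y|lborel. LINT x|lborel. g (x, y))"
  using lborel_pair.integral_snd[of "\<lambda>x y. g (x, y)", unfolded lborel_prod case_prod_eta, OF assms]
  by simp

lemma lborel_integral_substitution:
  fixes H :: "real \<Rightarrow> 'a::euclidean_space"
  assumes "\<And>x. (g has_real_derivative g' x) (at x)" "\<And>x. g' x > 0" "bij g"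
    and "integrable lborel H" "integrable lborel (\<lambda>x. g' x *\<^sub>R H (g x))"
  shows "(LINT x|lborel. g' x *\<^sub>R H (g x)) = integral\<^sup>L lborel H"
proof -
  \<comment> \<open>The change of variables is carried out for the gauge integral; the two
    integrability hypotheses bring both sides back to \<open>lborel\<close>.\<close>
  have "H absolutely_integrable_on UNIV"
    using assms(4) by (simp add: set_integrable_def integrable_completion)
  then have "integral UNIV (\<lambda>x. \<bar>g' x\<bar> *\<^sub>R H (g x)) = integral UNIV H"
    using has_absolute_integral_change_of_variables_real[of UNIV g g' H "integral UNIV H"] assms
    by (simp add: bij_is_inj bij_is_surj)
  moreover have "\<bar>g' x\<bar> = g' x" for x
    using assms(2)[of x] by simp
  ultimately show ?thesis
    using integral_lborel[OF assms(4)] integral_lborel[OF assms(5)] by simp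
qed


subsection \<open>Test functions\<close>

text \<open>Keeps just the part of \<open>test_functions\<close> that makes the trace integral
  converge and is visibly stable under composition with lifts and multiplication by continuous
  factors. Asking for some compact K instead of the closure of the support avoids recomputing
  supports.\<close>

definition Cc :: "(real \<times> real \<Rightarrow> complex) set" where
  "Cc = {f. continuous_on UNIV f \<and> (\<exists>K. compact K \<and> K \<subseteq> Fplus \<and> (\<forall>p. p \<notin> K \<longrightarrow> f p = 0))}"

lemma open_Fplus: "open Fplus"
  unfolding Fplus_def by (intro open_Times) auto

lemma Cc_continuous: "f \<in> Cc \<Longrightarrow> continuous_on UNIV f"
  by (simp add: Cc_def)

lemma Cc_support:
  assumes "f \<in> Cc"
  obtains K where "compact K" "K \<subseteq> Fplus" "\<And>p. p \<notin> K \<Longrightarrow> f p = 0"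
  using assms by (auto simp: Cc_def)

lemma CcI:
  "continuous_on UNIV f \<Longrightarrow> compact K \<Longrightarrow> K \<subseteq> Fplus \<Longrightarrow> (\<And>p. p \<notin> K \<Longrightarrow> f p = 0) \<Longrightarrow> f \<in> Cc"
  by (auto simp: Cc_def)

lemma Cc_zero: "(\<lambda>_. 0) \<in> Cc"
  by (rule CcI[of _ "{}"]) auto

lemma Cc_add:
  assumes "f \<in> Cc" "g \<in> Cc"
  shows "(\<lambda>p. f p + g p) \<in> Cc"
proof -
  obtain K where K: "compact K" "K \<subseteq> Fplus" "\<And>p. p \<notin> K \<Longrightarrow> f p = 0"
    using assms(1) by (rule Cc_support) blast
  obtain L where L: "compact L" "L \<subseteq> Fplus" "\<And>p. p \<notin> L \<Longrightarrow> g p = 0"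
    using assms(2) by (rule Cc_support) blast
  show ?thesis
  proof (rule CcI)
    show "continuous_on UNIV (\<lambda>p. f p + g p)"
      by (intro continuous_on_add Cc_continuous assms)
    show "compact (K \<union> L)"
      using K L by blast
  qed (use K L in auto)
qed

lemma Cc_sum: "(\<And>i. i \<in> I \<Longrightarrow> f i \<in> Cc) \<Longrightarrow> (\<lambda>p. \<Sum>i\<in>I. f i p) \<in> Cc"
  by (induction I rule: infinite_finite_induct) (auto simp: Cc_zero intro: Cc_add)

text \<open>The factor g may blow up at y = 0, as the weight y^-2 does: the product is continuous on
  \<open>Fplus\<close>, is zero on the complement of K, and these two open sets cover the
  plane.\<close>

lemma Cc_mult:
  assumes "f \<in> Cc" "continuous_on Fplus g"
  shows "(\<lambda>p. f p * g p) \<in> Cc"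
proof -
  obtain K where K: "compact K" "K \<subseteq> Fplus" "\<And>p. p \<notin> K \<Longrightarrow> f p = 0"
    using assms(1) by (rule Cc_support) blast
  have "continuous_on Fplus (\<lambda>p. f p * g p)"
    by (intro continuous_on_mult assms(2) continuous_on_subset[OF Cc_continuous[OF assms(1)]]) simp
  moreover have "continuous_on (- K) (\<lambda>p. f p * g p)"
    using K(3) by (subst continuous_on_cong[OF refl, of _ _ "\<lambda>_. 0"]) auto
  ultimately have "continuous_on (Fplus \<union> - K) (\<lambda>p. f p * g p)"
    by (intro continuous_on_open_Un open_Fplus) (auto simp: K(1) compact_imp_closed)
  moreover have "Fplus \<union> - K = UNIV"
    using K(2) by auto
  ultimately show ?thesis
    using K by (intro CcI[of _ K]) auto
qed

text \<open>Extension by zero is smooth across the boundary because the compact support stays away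
  from it. From here on derivatives can be taken on the whole plane.\<close>

lemma test_functions_iff:
  "f \<in> test_functions \<longleftrightarrow>
    smooth_on UNIV f \<and> (\<exists>K. compact K \<and> K \<subseteq> Fplus \<and> (\<forall>p. p \<notin> K \<longrightarrow> f p = 0))"
proof
  assume f: "f \<in> test_functions"
  define K where "K = closure {p. f p \<noteq> 0}"
  have K: "compact K" "K \<subseteq> Fplus" "f p = 0" if "p \<notin> K" for p
    using f that closure_subset[of "{p. f p \<noteq> 0}"] by (auto simp: test_functions_def K_def)
  have K': "compact K" "K \<subseteq> Fplus"
    using f by (auto simp: test_functions_def K_def)
  have "higher_differentiable_on UNIV f n" for n
  proof -
    have "higher_differentiable_on (- K) f n"
      by (rule higher_differentiable_on_cong[of _ "\<lambda>_. 0"])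
        (use K(3) K'(1) in \<open>auto simp: compact_imp_closed higher_differentiable_on_const\<close>)
    moreover have "higher_differentiable_on Fplus f n"
      using f by (auto simp: test_functions_def smooth_on_def)
    ultimately have "higher_differentiable_on (Fplus \<union> - K) f n"
      using K'(1) by (intro higher_differentiable_on_Un open_Fplus) (auto simp: compact_imp_closed)
    moreover have "Fplus \<union> - K = UNIV"
      using K'(2) by auto
    ultimately show ?thesis
      by simp
  qed
  then show "smooth_on UNIV f \<and> (\<exists>K. compact K \<and> K \<subseteq> Fplus \<and> (\<forall>p. p \<notin> K \<longrightarrow> f p = 0))"
    using K(3) K' unfolding smooth_on_def by blast
next
  assume "smooth_on UNIV f \<and> (\<exists>K. compact K \<and> K \<subseteq> Fplus \<and> (\<forall>p. p \<notin> K \<longrightarrow> f p = 0))"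
  then obtain K where f: "smooth_on UNIV f"
    and K: "compact K" "K \<subseteq> Fplus" "\<And>p. p \<notin> K \<Longrightarrow> f p = 0"
    by blast
  have sub: "closure {p. f p \<noteq> 0} \<subseteq> K"
    using K by (intro closure_minimal) (auto simp: compact_imp_closed)
  then have "compact (closure {p. f p \<noteq> 0})" "closure {p. f p \<noteq> 0} \<subseteq> Fplus"
    using K compact_Int_closed[OF K(1) closed_closure, of "{p. f p \<noteq> 0}"]
    by (auto simp: Int_absorb1)
  moreover have "smooth_on Fplus f"
    using f higher_differentiable_on_subset[of UNIV f _ Fplus] by (auto simp: smooth_on_def)
  ultimately show "f \<in> test_functions"
    by (simp add: test_functions_def)
qed

lemma test_functions_Cc: "f \<in> test_functions \<Longrightarrow> f \<in> Cc"
  by (auto simp: test_functions_iff Cc_def smooth_on_continuous)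

text \<open>For v = (1, 0) and v = (0, 1) this is X and Y on a single coefficient. The support does
  not grow, since f is locally zero off K.\<close>

lemma test_functions_derivative:
  assumes "f \<in> test_functions"
  shows "(\<lambda>p. complex_of_real (snd p) * frechet_derivative f (at p) v) \<in> test_functions"
proof -
  obtain K where f: "smooth_on UNIV f"
    and K: "compact K" "K \<subseteq> Fplus" "\<And>p. p \<notin> K \<Longrightarrow> f p = 0"
    using assms by (auto simp: test_functions_iff)
  have "smooth_on UNIV (\<lambda>p. snd p *\<^sub>R frechet_derivative f (at p) v)"
    by (intro smooth_on_scaleR smooth_on_frechet_derivative f smooth_on_bounded_linear
        bounded_linear_snd open_UNIV)
  moreover have "frechet_derivative f (at p) v = 0" if "p \<notin> K" for p
  proof -
    have "(f has_derivative (\<lambda>_. 0)) (at p)"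
      by (rule has_derivative_transform_within_open[of "\<lambda>_. 0" _ _ _ "- K"])
        (use that K in \<open>auto simp: compact_imp_closed\<close>)
    then show ?thesis
      by (simp add: frechet_derivative_at_eq)
  qed
  ultimately show ?thesis
    unfolding test_functions_iff scaleR_conv_of_real using K by (metis mult_zero_right)
qed


subsection \<open>The action of the diffeomorphism group\<close>

locale diffeo_group =
  fixes \<Gamma> :: "(real \<Rightarrow> real) set"
  assumes subgroup: "subgroup \<Gamma> Diff_plus"
begin

lemma
  assumes "\<phi> \<in> \<Gamma>"
  shows bij_diffeo: "bij \<phi>"
    and diffeo_deriv: "(\<phi> has_real_derivative deriv \<phi> x) (at x)"
    and diffeo_deriv_deriv: "(deriv \<phi> has_real_derivative deriv (deriv \<phi>) x) (at x)"
    and smooth_deriv_deriv: "smooth_on UNIV (deriv (deriv \<phi>))"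
    and diffeo_deriv_pos: "deriv \<phi> x > 0"
  using subgroup.mem_carrier[OF subgroup assms]
  by (auto simp: Diff_plus_def intro!: smooth_on_has_real_derivative smooth_on_deriv)

lemma diffeo_deriv_nonzero: "\<phi> \<in> \<Gamma> \<Longrightarrow> deriv \<phi> x \<noteq> 0"
  using diffeo_deriv_pos less_irrefl by metis

lemma comp_diffeo: "\<psi> \<in> \<Gamma> \<Longrightarrow> \<phi> \<in> \<Gamma> \<Longrightarrow> \<psi> \<circ> \<phi> \<in> \<Gamma>"
  using subgroup.m_closed[OF subgroup] by (simp add: Diff_plus_def)

text \<open>Subgroups are closed under \<open>m_inv\<close>, a definite description, so the
  functional inverse has to be identified with it. That its derivative is positive follows from the
  chain rule applied to the composite of \<phi> with its inverse.\<close>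

lemma inv_diffeo:
  assumes "\<phi> \<in> \<Gamma>"
  shows "inv_into UNIV \<phi> \<in> \<Gamma>"
proof -
  have \<phi>: "bij \<phi>" "smooth_on UNIV \<phi>" "smooth_on UNIV (inv_into UNIV \<phi>)"
    using subgroup.mem_carrier[OF subgroup assms] by (auto simp: Diff_plus_def)
  have "deriv (inv_into UNIV \<phi>) x > 0" for x
  proof -
    have "(\<phi> \<circ> inv_into UNIV \<phi> has_real_derivative deriv \<phi> (inv_into UNIV \<phi> x) * deriv (inv_into UNIV \<phi>) x) (at x)"
      by (intro DERIV_chain diffeo_deriv[OF assms] smooth_on_has_real_derivative \<phi>)
    moreover have "\<phi> \<circ> inv_into UNIV \<phi> = id"
      by (rule surj_iff[THEN iffD1, OF bij_is_surj[OF \<phi>(1)]])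
    ultimately have "deriv \<phi> (inv_into UNIV \<phi> x) * deriv (inv_into UNIV \<phi>) x = 1"
      using DERIV_unique[OF _ DERIV_ident] by (simp add: id_def)
    then show ?thesis
      using diffeo_deriv_pos[OF assms, of "inv_into UNIV \<phi> x"] by (smt (verit) zero_less_mult_iff)
  qed
  then have inv_carrier: "inv_into UNIV \<phi> \<in> carrier Diff_plus"
    using \<phi> by (simp add: Diff_plus_def bij_imp_bij_inv inv_inv_eq)
  have "m_inv Diff_plus \<phi> = inv_into UNIV \<phi>"
    unfolding m_inv_def
  proof (rule the_equality)
    show "inv_into UNIV \<phi> \<in> carrier Diff_plus \<and> \<phi> \<otimes>\<^bsub>Diff_plus\<^esub> inv_into UNIV \<phi> = \<one>\<^bsub>Diff_plus\<^esub> \<and>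
        inv_into UNIV \<phi> \<otimes>\<^bsub>Diff_plus\<^esub> \<phi> = \<one>\<^bsub>Diff_plus\<^esub>"
      using inv_carrier \<phi>(1) by (simp add: Diff_plus_def bij_is_surj bij_is_inj surj_iff[symmetric] inj_iff[symmetric])
    show "\<psi> = inv_into UNIV \<phi>" if "\<psi> \<in> carrier Diff_plus \<and> \<phi> \<otimes>\<^bsub>Diff_plus\<^esub> \<psi> = \<one>\<^bsub>Diff_plus\<^esub> \<and>
        \<psi> \<otimes>\<^bsub>Diff_plus\<^esub> \<phi> = \<one>\<^bsub>Diff_plus\<^esub>" for \<psi>
      using that by (auto simp: Diff_plus_def intro: inv_unique_comp[symmetric])
  qed
  then show ?thesis
    using subgroup.m_inv_closed[OF subgroup assms] by simp
qed

lemma inv_comp_diffeo: "\<phi> \<in> \<Gamma> \<Longrightarrow> inv_into UNIV \<phi> \<circ> \<phi> = id" "\<phi> \<in> \<Gamma> \<Longrightarrow> \<phi> \<circ> inv_into UNIV \<phi> = id"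
  using bij_diffeo by (auto simp: bij_is_inj bij_is_surj surj_iff[symmetric])

text \<open>Solving for \<psi> collapses the double sum in \<open>alg_mult\<close> to a convolution
  with one index.\<close>

lemma comp_eq_iff: "\<phi> \<in> \<Gamma> \<Longrightarrow> \<psi> \<circ> \<phi> = \<rho> \<longleftrightarrow> \<psi> = \<rho> \<circ> inv_into UNIV \<phi>"
  using inv_comp_diffeo by (metis comp_assoc comp_id)

lemma deriv_comp_diffeo:
  assumes "\<psi> \<in> \<Gamma>" "\<phi> \<in> \<Gamma>"
  shows "deriv (\<psi> \<circ> \<phi>) = (\<lambda>x. deriv \<psi> (\<phi> x) * deriv \<phi> x)"
  by (intro ext DERIV_imp_deriv DERIV_chain diffeo_deriv assms)

text \<open>Divided by the first derivative of the composite, this is the cocycle identity for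
  \<phi>''/\<phi>' = (log \<phi>')', the reason why \<open>delta1\<close> is a derivation.\<close>

lemma deriv_deriv_comp_diffeo:
  assumes "\<psi> \<in> \<Gamma>" "\<phi> \<in> \<Gamma>"
  shows "deriv (deriv (\<psi> \<circ> \<phi>)) x =
    deriv (deriv \<psi>) (\<phi> x) * (deriv \<phi> x)\<^sup>2 + deriv \<psi> (\<phi> x) * deriv (deriv \<phi>) x"
  unfolding deriv_comp_diffeo[OF assms]
  by (intro DERIV_imp_deriv)
    (auto intro!: derivative_eq_intros DERIV_chain2[OF diffeo_deriv_deriv[OF assms(1)] diffeo_deriv[OF assms(2)]]
      diffeo_deriv_deriv[OF assms(2)] simp: power2_eq_square)

lemma lift_comp: "\<psi> \<in> \<Gamma> \<Longrightarrow> \<phi> \<in> \<Gamma> \<Longrightarrow> lift (\<psi> \<circ> \<phi>) p = lift \<psi> (lift \<phi> p)"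
  by (cases p) (simp add: lift_def deriv_comp_diffeo)

lemma lift_id: "lift id p = p"
  by (cases p) (simp add: lift_def id_def)

lemma lift_inv: "\<phi> \<in> \<Gamma> \<Longrightarrow> lift (inv_into UNIV \<phi>) (lift \<phi> p) = p" "\<phi> \<in> \<Gamma> \<Longrightarrow> lift \<phi> (lift (inv_into UNIV \<phi>) p) = p"
  by (simp_all add: inv_diffeo inv_comp_diffeo lift_id flip: lift_comp)

lemma lift_has_derivative:
  assumes "\<phi> \<in> \<Gamma>"
  shows "(lift \<phi> has_derivative (\<lambda>v. (deriv \<phi> (fst p) * fst v,
      deriv (deriv \<phi>) (fst p) * snd p * fst v + deriv \<phi> (fst p) * snd v))) (at p)"
proof -
  have 1: "((\<lambda>p. \<phi> (fst p)) has_derivative (\<lambda>v. deriv \<phi> (fst p) * fst v)) (at p)"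
    using has_derivative_compose[OF has_derivative_fst[OF has_derivative_ident]
        diffeo_deriv[OF assms, unfolded has_field_derivative_def]] .
  have 2: "((\<lambda>p. deriv \<phi> (fst p)) has_derivative (\<lambda>v. deriv (deriv \<phi>) (fst p) * fst v)) (at p)"
    using has_derivative_compose[OF has_derivative_fst[OF has_derivative_ident]
        diffeo_deriv_deriv[OF assms, unfolded has_field_derivative_def]] .
  have "((\<lambda>p. (\<phi> (fst p), deriv \<phi> (fst p) * snd p)) has_derivative (\<lambda>v. (deriv \<phi> (fst p) * fst v,
      deriv \<phi> (fst p) * snd v + deriv (deriv \<phi>) (fst p) * fst v * snd p))) (at p)"
    by (intro has_derivative_Pair has_derivative_mult 1 2 has_derivative_snd has_derivative_ident)
  moreover have "lift \<phi> = (\<lambda>p. (\<phi> (fst p), deriv \<phi> (fst p) * snd p))"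
    by (auto simp: lift_def)
  ultimately show ?thesis
    by (simp add: algebra_simps)
qed

lemma continuous_lift: "\<phi> \<in> \<Gamma> \<Longrightarrow> continuous_on S (lift \<phi>)"
  by (meson continuous_at_imp_continuous_on has_derivative_continuous lift_has_derivative)

text \<open>The Jacobian of \<^term>\<open>lift \<phi>\<close> is \<open>\<phi>'\<^sup>2\<close>; one factor comes from each variable in Fubini's theorem.\<close>

lemma integral_lift:
  fixes g :: "real \<times> real \<Rightarrow> complex"
  assumes "\<phi> \<in> \<Gamma>" and g: "continuous_on UNIV g" and K: "compact K" "\<And>p. p \<notin> K \<Longrightarrow> g p = 0"
  shows "(LINT p|lborel. (deriv \<phi> (fst p))\<^sup>2 *\<^sub>R g (lift \<phi> p)) = integral\<^sup>L lborel g"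
proof -
  define H where "H = (\<lambda>x. LINT y|lborel. g (x, y))"
  let ?G = "\<lambda>p. (deriv \<phi> (fst p))\<^sup>2 *\<^sub>R g (lift \<phi> p)"
  have "continuous_on UNIV (deriv \<phi>)"
    using DERIV_isCont[OF diffeo_deriv_deriv[OF assms(1)]] by (simp add: continuous_on_eq_continuous_at)
  then have "continuous_on UNIV (\<lambda>p. deriv \<phi> (fst p))"
    by (rule continuous_on_compose2) (auto intro: continuous_on_fst continuous_on_id)
  moreover have "continuous_on UNIV (\<lambda>p. g (lift \<phi> p))"
    by (rule continuous_on_compose2[OF g continuous_lift[OF assms(1)]]) simp
  ultimately have "continuous_on UNIV ?G"
    by (intro continuous_on_scaleR continuous_on_power)
  \<comment> \<open>The preimage of K under \<open>lift \<phi>\<close>, written as an image under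
    the inverse lift so that compactness is immediate.\<close>
  moreover have "compact (lift (inv_into UNIV \<phi>) ` K)"
    by (intro compact_continuous_image continuous_lift inv_diffeo assms)
  moreover have "?G p = 0" if "p \<notin> lift (inv_into UNIV \<phi>) ` K" for p
    using that K(2)[of "lift \<phi> p"] lift_inv(1)[OF assms(1), of p] by (metis image_eqI scaleR_zero_right)
  ultimately have G: "integrable lborel ?G"
    by (rule integrable_compact_support)
  have inner: "(LINT y|lborel. ?G (x, y)) = deriv \<phi> x *\<^sub>R H (\<phi> x)" for x
  proof -
    have "H (\<phi> x) = deriv \<phi> x *\<^sub>R (LINT y|lborel. g (\<phi> x, deriv \<phi> x * y))"
      unfolding H_def
      using lborel_integral_real_affine[of "deriv \<phi> x" "\<lambda>y. g (\<phi> x, y)" 0]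
        diffeo_deriv_pos[OF assms(1), of x] by simp
    then show ?thesis
      by (simp add: lift_def power2_eq_square)
  qed
  have "integral\<^sup>L lborel ?G = (LINT x|lborel. deriv \<phi> x *\<^sub>R H (\<phi> x))"
    unfolding lborel_integral_fst(2)[OF G] inner ..
  also have "\<dots> = integral\<^sup>L lborel H"
  proof (rule lborel_integral_substitution)
    show "integrable lborel H"
      unfolding H_def by (intro lborel_integral_fst integrable_compact_support[OF g K])
    show "integrable lborel (\<lambda>x. deriv \<phi> x *\<^sub>R H (\<phi> x))"
      using lborel_integral_fst(1)[OF G] unfolding inner .
  qed (intro diffeo_deriv diffeo_deriv_pos bij_diffeo assms(1))+
  also have "\<dots> = integral\<^sup>L lborel g"
    unfolding H_def by (rule lborel_integral_fst(2)[symmetric, OF integrable_compact_support[OF g K]])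
  finally show ?thesis .
qed

end


subsection \<open>The operators \<open>X\<close>, \<open>Y\<close>, \<open>\<delta>\<^sub>1\<close> and the trace\<close>

text \<open>Home of the products and of the images of \<open>delta1\<close>; the trace lemmas are
  stated over it.\<close>

definition Cc_algebra :: "(real \<Rightarrow> real) set \<Rightarrow> alg set" where
  "Cc_algebra \<Gamma> = {a. finite (supp a) \<and> supp a \<subseteq> \<Gamma> \<and> range a \<subseteq> Cc}"

lemma Cc_algebraD:
  assumes "a \<in> Cc_algebra \<Gamma>"
  shows "finite (supp a)" "supp a \<subseteq> \<Gamma>" "a \<phi> \<in> Cc"
  using assms by (auto simp: Cc_algebra_def)

lemma Cc_algebraI:
  "finite A \<Longrightarrow> A \<subseteq> \<Gamma> \<Longrightarrow> (\<And>\<phi>. \<phi> \<notin> A \<Longrightarrow> a \<phi> = (\<lambda>_. 0)) \<Longrightarrow> (\<And>\<phi>. a \<phi> \<in> Cc) \<Longrightarrow> a \<in> Cc_algebra \<Gamma>"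
  unfolding Cc_algebra_def supp_def by (auto intro: finite_subset)

lemma crossed_algebraI:
  "finite A \<Longrightarrow> A \<subseteq> \<Gamma> \<Longrightarrow> (\<And>\<phi>. \<phi> \<notin> A \<Longrightarrow> a \<phi> = (\<lambda>_. 0)) \<Longrightarrow> (\<And>\<phi>. a \<phi> \<in> test_functions) \<Longrightarrow>
    a \<in> crossed_algebra \<Gamma>"
  unfolding crossed_algebra_def supp_def by (auto intro: finite_subset)

lemma crossed_algebraD:
  assumes "a \<in> crossed_algebra \<Gamma>"
  shows "finite (supp a)" "supp a \<subseteq> \<Gamma>" "a \<phi> \<in> test_functions"
  using assms by (auto simp: crossed_algebra_def)

lemma crossed_Cc_algebra: "a \<in> crossed_algebra \<Gamma> \<Longrightarrow> a \<in> Cc_algebra \<Gamma>"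
  unfolding crossed_algebra_def Cc_algebra_def using test_functions_Cc by auto

lemma supp_zero: "\<phi> \<notin> supp a \<Longrightarrow> a \<phi> = (\<lambda>_. 0)"
  by (simp add: supp_def)

text \<open>The regularity at which X and Y of a product are computed: one application of the chain
  rule.\<close>

definition differentiable_alg :: "alg \<Rightarrow> bool" where
  "differentiable_alg a \<longleftrightarrow> (\<forall>\<phi> p. a \<phi> differentiable (at p))"

lemma differentiable_algD: "differentiable_alg a \<Longrightarrow> a \<phi> differentiable (at p)"
  unfolding differentiable_alg_def by blast

lemma crossed_differentiable: "a \<in> crossed_algebra \<Gamma> \<Longrightarrow> differentiable_alg a"
  unfolding differentiable_alg_def
  using crossed_algebraD(3) test_functions_iff smooth_on_differentiable by blast

lemma opX_eq:
  assumes "differentiable_alg a"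
  shows "opX a \<phi> p = of_real (snd p) * frechet_derivative (a \<phi>) (at p) (1, 0)"
  by (cases p) (simp add: opX_def
      vector_derivative_at[OF partial_fst_has_vector_derivative[OF differentiable_algD[OF assms]]])

lemma opY_eq:
  assumes "differentiable_alg a"
  shows "opY a \<phi> p = of_real (snd p) * frechet_derivative (a \<phi>) (at p) (0, 1)"
  by (cases p) (simp add: opY_def
      vector_derivative_at[OF partial_snd_has_vector_derivative[OF differentiable_algD[OF assms]]])

lemma opX_zero: "a \<phi> = (\<lambda>_. 0) \<Longrightarrow> opX a \<phi> = (\<lambda>_. 0)"
  by (auto simp: opX_def)

lemma opY_zero: "a \<phi> = (\<lambda>_. 0) \<Longrightarrow> opY a \<phi> = (\<lambda>_. 0)"
  by (auto simp: opY_def)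

lemma delta1_zero: "a \<phi> = (\<lambda>_. 0) \<Longrightarrow> delta1 a \<phi> = (\<lambda>_. 0)"
  by (auto simp: delta1_def)

lemma crossed_opX:
  assumes "a \<in> crossed_algebra \<Gamma>"
  shows "opX a \<in> crossed_algebra \<Gamma>"
proof (rule crossed_algebraI)
  show "opX a \<phi> \<in> test_functions" for \<phi>
  proof -
    have "opX a \<phi> = (\<lambda>p. of_real (snd p) * frechet_derivative (a \<phi>) (at p) (1, 0))"
      by (rule ext) (rule opX_eq[OF crossed_differentiable[OF assms]])
    then show ?thesis
      using test_functions_derivative[OF crossed_algebraD(3)[OF assms]] by simp
  qed
qed (use crossed_algebraD[OF assms] in \<open>auto intro: opX_zero supp_zero\<close>)

lemma crossed_opY:
  assumes "a \<in> crossed_algebra \<Gamma>"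
  shows "opY a \<in> crossed_algebra \<Gamma>"
proof (rule crossed_algebraI)
  show "opY a \<phi> \<in> test_functions" for \<phi>
  proof -
    have "opY a \<phi> = (\<lambda>p. of_real (snd p) * frechet_derivative (a \<phi>) (at p) (0, 1))"
      by (rule ext) (rule opY_eq[OF crossed_differentiable[OF assms]])
    then show ?thesis
      using test_functions_derivative[OF crossed_algebraD(3)[OF assms]] by simp
  qed
qed (use crossed_algebraD[OF assms] in \<open>auto intro: opY_zero supp_zero\<close>)

lemma opX_add:
  assumes "differentiable_alg a" "differentiable_alg b"
  shows "opX (alg_add a b) = alg_add (opX a) (opX b)"
proof (intro ext)
  fix \<phi> p
  have "((\<lambda>s. a \<phi> (s, snd p) + b \<phi> (s, snd p)) has_vector_derivative
      frechet_derivative (a \<phi>) (at (fst p, snd p)) (1, 0) +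
      frechet_derivative (b \<phi>) (at (fst p, snd p)) (1, 0)) (at (fst p))"
    by (rule has_vector_derivative_add[OF
          partial_fst_has_vector_derivative[OF differentiable_algD[OF assms(1)]]
          partial_fst_has_vector_derivative[OF differentiable_algD[OF assms(2)]]])
  then show "opX (alg_add a b) \<phi> p = alg_add (opX a) (opX b) \<phi> p"
    by (cases p) (simp add: alg_add_def opX_eq[OF assms(1)] opX_eq[OF assms(2)]
      vector_derivative_at opX_def[of "\<lambda>\<phi> p. a \<phi> p + b \<phi> p"] distrib_left)
qed

lemma opX_scale:
  assumes "differentiable_alg a"
  shows "opX (alg_scale c a) = alg_scale c (opX a)"
proof (intro ext)
  fix \<phi> p
  have "((\<lambda>s. c * a \<phi> (s, snd p)) has_vector_derivative
      c * frechet_derivative (a \<phi>) (at (fst p, snd p)) (1, 0)) (at (fst p))"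
    by (intro has_vector_derivative_mult_right partial_fst_has_vector_derivative
        differentiable_algD[OF assms])
  then show "opX (alg_scale c a) \<phi> p = alg_scale c (opX a) \<phi> p"
    by (cases p) (simp add: opX_def alg_scale_def vector_derivative_at
      vector_derivative_at[OF partial_fst_has_vector_derivative[OF differentiable_algD[OF assms]]])
qed

lemma delta1_add: "delta1 (alg_add a b) = alg_add (delta1 a) (delta1 b)"
  by (auto simp: delta1_def alg_add_def distrib_left fun_eq_iff)

lemma delta1_scale: "delta1 (alg_scale c a) = alg_scale c (delta1 a)"
  by (auto simp: delta1_def alg_scale_def mult_ac fun_eq_iff)

text \<open>\<open>delta1\<close> multiplies by y times a function of x, and y d/dy reproduces the
  factor y; this is the extra summand.\<close>

lemma opY_delta1:
  assumes "differentiable_alg a"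
  shows "opY (delta1 a) = alg_add (delta1 (opY a)) (delta1 a)"
proof (intro ext)
  fix \<phi> and p :: "real \<times> real"
  obtain x y where p: "p = (x, y)"
    by (cases p)
  define c where "c = deriv (deriv \<phi>) x / deriv \<phi> x"
  let ?D = "frechet_derivative (a \<phi>) (at (x, y)) (0, 1)"
  have D: "((\<lambda>s. a \<phi> (x, s)) has_vector_derivative ?D) (at y)"
    by (intro partial_snd_has_vector_derivative differentiable_algD[OF assms])
  have "((\<lambda>s. complex_of_real (s * c)) has_vector_derivative of_real c) (at y)"
    by (auto intro!: derivative_eq_intros simp: has_vector_derivative_def scaleR_conv_of_real)
  from has_vector_derivative_mult[OF this D]
  have "((\<lambda>s. of_real (s * c) * a \<phi> (x, s)) has_vector_derivative
      of_real (y * c) * ?D + of_real c * a \<phi> (x, y)) (at y)" .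
  moreover have delta1: "delta1 f \<phi> (x, s) = of_real (s * c) * f \<phi> (x, s)" for f s
    by (simp add: delta1_def c_def)
  ultimately have "opY (delta1 a) \<phi> (x, y) = of_real y * (of_real (y * c) * ?D + of_real c * a \<phi> (x, y))"
    by (simp only: opY_def prod.case vector_derivative_at)
  then show "opY (delta1 a) \<phi> p = alg_add (delta1 (opY a)) (delta1 a) \<phi> p"
    by (simp add: p delta1 alg_add_def opY_eq[OF assms] algebra_simps)
qed

text \<open>Y also differentiates the factor y contained in X, which yields the extra X; the
  second-order terms on the two sides agree by symmetry of the mixed partials.\<close>

lemma opY_opX:
  assumes "a \<in> crossed_algebra \<Gamma>"
  shows "opY (opX a) = alg_add (opX (opY a)) (opX a)"
proof (intro ext)
  fix \<phi> p
  have smooth: "smooth_on UNIV (a \<phi>)"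
    using crossed_algebraD(3)[OF assms] by (simp add: test_functions_iff)
  have X: "opX a \<phi> = (\<lambda>p. snd p *\<^sub>R frechet_derivative (a \<phi>) (at p) (1, 0))"
    using opX_eq[OF crossed_differentiable[OF assms]] by (auto simp: scaleR_conv_of_real)
  have Y: "opY a \<phi> = (\<lambda>p. snd p *\<^sub>R frechet_derivative (a \<phi>) (at p) (0, 1))"
    using opY_eq[OF crossed_differentiable[OF assms]] by (auto simp: scaleR_conv_of_real)
  \<comment> \<open>The last summand survives for v = (0, 1) and disappears for v = (1, 0): hence
    the asymmetry between the two orders of X and Y.\<close>
  have D: "frechet_derivative (\<lambda>p. snd p *\<^sub>R frechet_derivative (a \<phi>) (at p) u) (at p) v =
    snd p *\<^sub>R frechet_derivative (\<lambda>p. frechet_derivative (a \<phi>) (at p) u) (at p) v +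
    snd v *\<^sub>R frechet_derivative (a \<phi>) (at p) u" for u v
  proof -
    have "((\<lambda>p. snd p *\<^sub>R frechet_derivative (a \<phi>) (at p) u) has_derivative
      (\<lambda>v. snd p *\<^sub>R frechet_derivative (\<lambda>p. frechet_derivative (a \<phi>) (at p) u) (at p) v +
        snd v *\<^sub>R frechet_derivative (a \<phi>) (at p) u)) (at p)"
      by (intro has_derivative_scaleR has_derivative_snd has_derivative_ident
          differentiable_has_derivative smooth_on_differentiable[OF smooth_on_frechet_derivative[OF smooth] UNIV_I])
    then show ?thesis
      by (simp add: frechet_derivative_at_eq)
  qed
  show "opY (opX a) \<phi> p = alg_add (opX (opY a)) (opX a) \<phi> p"
    unfolding alg_add_def opX_eq[OF crossed_differentiable[OF crossed_opY[OF assms]]]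
      opY_eq[OF crossed_differentiable[OF crossed_opX[OF assms]]] X Y D
    using mixed_partials_eq[OF smooth, of p] by (simp add: algebra_simps scaleR_conv_of_real)
qed

section \<open>The trace on \<open>Cc_algebra\<close>: linearity and integration by parts\<close>

lemma Cc_algebra_add:
  assumes "a \<in> Cc_algebra \<Gamma>" "b \<in> Cc_algebra \<Gamma>"
  shows "alg_add a b \<in> Cc_algebra \<Gamma>"
proof (rule Cc_algebraI)
  show "finite (supp a \<union> supp b)" "supp a \<union> supp b \<subseteq> \<Gamma>"
    using assms Cc_algebraD by blast+
  show "alg_add a b \<phi> = (\<lambda>_. 0)" if "\<phi> \<notin> supp a \<union> supp b" for \<phi>
    using that by (simp add: alg_add_def supp_def)
  show "alg_add a b \<phi> \<in> Cc" for \<phi>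
    unfolding alg_add_def by (intro Cc_add Cc_algebraD(3)[OF assms(1)] Cc_algebraD(3)[OF assms(2)])
qed

lemma Cc_algebra_scale:
  assumes "a \<in> Cc_algebra \<Gamma>"
  shows "alg_scale c a \<in> Cc_algebra \<Gamma>"
proof (rule Cc_algebraI)
  show "alg_scale c a \<phi> = (\<lambda>_. 0)" if "\<phi> \<notin> supp a" for \<phi>
    using that by (simp add: alg_scale_def supp_def)
  show "alg_scale c a \<phi> \<in> Cc" for \<phi>
    unfolding alg_scale_def
    using Cc_mult[OF Cc_algebraD(3)[OF assms], of "\<lambda>_. c" \<phi>] by (simp add: mult.commute)
qed (intro Cc_algebraD[OF assms])+

lemma Cc_weight:
  assumes "f \<in> Cc"
  shows "(\<lambda>p. f p / of_real ((snd p)\<^sup>2)) \<in> Cc"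
proof -
  have "continuous_on Fplus (\<lambda>p. 1 / complex_of_real ((snd p)\<^sup>2))"
    by (intro continuous_intros) (auto simp: Fplus_def)
  then show ?thesis
    using Cc_mult[OF assms] by fastforce
qed

lemma Cc_integrable: "f \<in> Cc \<Longrightarrow> integrable lborel f"
  by (metis Cc_continuous Cc_support integrable_compact_support)

text \<open>Off \<open>Fplus\<close> the coefficient vanishes, also on the line y = 0, where the
  quotient is 0 / 0 = 0. Fubini can then be used on the whole plane.\<close>

lemma tr_eq:
  assumes "a id \<in> Cc"
  shows "tr a = (LINT p|lborel. a id p / of_real ((snd p)\<^sup>2))"
proof -
  have "indicator Fplus p *\<^sub>R (a id p / of_real ((snd p)\<^sup>2)) = a id p / of_real ((snd p)\<^sup>2)" for p
    using assms by (cases "p \<in> Fplus") (auto elim!: Cc_support)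
  then show ?thesis
    by (simp add: tr_def set_lebesgue_integral_def)
qed

lemma tr_add:
  assumes "a \<in> Cc_algebra \<Gamma>" "b \<in> Cc_algebra \<Gamma>"
  shows "tr (alg_add a b) = tr a + tr b"
proof -
  have "tr (alg_add a b) = (LINT p|lborel. a id p / of_real ((snd p)\<^sup>2) + b id p / of_real ((snd p)\<^sup>2))"
    unfolding tr_eq[OF Cc_algebraD(3)[OF Cc_algebra_add[OF assms]]]
    by (simp add: alg_add_def add_divide_distrib)
  also have "\<dots> = tr a + tr b"
    unfolding tr_eq[OF Cc_algebraD(3)[OF assms(1)]] tr_eq[OF Cc_algebraD(3)[OF assms(2)]]
    by (intro Bochner_Integration.integral_add Cc_integrable Cc_weight Cc_algebraD(3)[OF assms(1)]
        Cc_algebraD(3)[OF assms(2)])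
  finally show ?thesis .
qed

lemma tr_scale: "tr (alg_scale c a) = c * tr a"
  by (simp add: tr_def alg_scale_def flip: set_integral_mult_right times_divide_eq_right)

text \<open>On a horizontal line the integrand is the x-derivative of a / y. The last hypothesis
  provides its continuity; for a product it comes from the Leibniz rule.\<close>

lemma tr_opX:
  assumes "a \<in> Cc_algebra \<Gamma>" "differentiable_alg a" "opX a \<in> Cc_algebra \<Gamma>"
  shows "tr (opX a) = 0"
proof -
  define g where "g = (\<lambda>p. opX a id p / of_real ((snd p)\<^sup>2))"
  have g: "g \<in> Cc"
    unfolding g_def by (intro Cc_weight Cc_algebraD(3)[OF assms(3)])
  obtain K where K: "compact K" "\<And>p. p \<notin> K \<Longrightarrow> a id p = 0"
    using Cc_algebraD(3)[OF assms(1)] by (rule Cc_support) blast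
  obtain L where L: "compact L" "\<And>p. p \<notin> L \<Longrightarrow> g p = 0"
    using g by (rule Cc_support) blast
  obtain r where r: "\<And>p. p \<in> K \<union> L \<Longrightarrow> norm p < r"
    using compact_imp_bounded[OF compact_Un[OF K(1) L(1)]] by (auto simp: bounded_pos_less)
  have "(LINT x|lborel. g (x, y)) = 0" for y
  proof (rule integral_derivative_compact_support)
    show "((\<lambda>x. a id (x, y) * inverse (of_real y)) has_vector_derivative g (x, y)) (at x)" for x
    proof -
      \<comment> \<open>Valid for y = 0 too, where both sides are 0 because
        \<open>inverse 0 = 0\<close>.\<close>
      have "g (x, y) = frechet_derivative (a id) (at (x, y)) (1, 0) * inverse (of_real y)"
        unfolding g_def opX_eq[OF assms(2)] by (simp add: power2_eq_square field_simps)
      then show ?thesis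
        by (simp only:)
          (intro has_vector_derivative_mult_left partial_fst_has_vector_derivative
            differentiable_algD[OF assms(2)])
    qed
    show "continuous_on UNIV (\<lambda>x. g (x, y))"
      by (rule continuous_on_compose2[OF Cc_continuous[OF g]]) (intro continuous_intros subset_UNIV)+
    show "a id (x, y) * inverse (of_real y) = 0" if "r \<le> \<bar>x\<bar>" for x
      using that r[of "(x, y)"] norm_fst_le[of x y] K(2)[of "(x, y)"] by force
    show "g (x, y) = 0" if "r \<le> \<bar>x\<bar>" for x
      using that r[of "(x, y)"] norm_fst_le[of x y] L(2)[of "(x, y)"] by force
  qed
  then have "integral\<^sup>L lborel g = 0"
    unfolding lborel_integral_snd[OF Cc_integrable[OF g]] by simp
  then show ?thesis
    unfolding tr_eq[OF Cc_algebraD(3)[OF assms(3)]] g_def .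
qed

text \<open>On a vertical line y^-2 (Y(a) - a) is the y-derivative of a / y, so the difference b
  below has trace 0.\<close>

lemma tr_opY:
  assumes "a \<in> Cc_algebra \<Gamma>" "differentiable_alg a" "opY a \<in> Cc_algebra \<Gamma>"
  shows "tr (opY a) = tr a"
proof -
  define b where "b = alg_add (opY a) (alg_scale (-1) a)"
  have b: "b \<in> Cc_algebra \<Gamma>"
    unfolding b_def by (intro Cc_algebra_add Cc_algebra_scale assms)
  define g where "g = (\<lambda>p. b id p / of_real ((snd p)\<^sup>2))"
  have g: "g \<in> Cc"
    unfolding g_def by (intro Cc_weight Cc_algebraD(3)[OF b])
  obtain K where K: "compact K" "K \<subseteq> Fplus" "\<And>p. p \<notin> K \<Longrightarrow> a id p = 0"
    using Cc_algebraD(3)[OF assms(1)] by (rule Cc_support) blast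
  obtain L where L: "compact L" "\<And>p. p \<notin> L \<Longrightarrow> g p = 0"
    using g by (rule Cc_support) blast
  obtain r where r: "\<And>p. p \<in> K \<union> L \<Longrightarrow> norm p < r"
    using compact_imp_bounded[OF compact_Un[OF K(1) L(1)]] by (auto simp: bounded_pos_less)
  have "(LINT y|lborel. g (x, y)) = 0" for x
  proof (rule integral_derivative_compact_support)
    let ?F = "\<lambda>y. a id (x, y) * of_real (inverse y)"
    show "(?F has_vector_derivative g (x, y)) (at y)" for y
    proof (cases "y = 0")
      case False
      have "((\<lambda>y. complex_of_real (inverse y)) has_vector_derivative of_real (- inverse (y\<^sup>2))) (at y)"
        using False
        by (intro has_vector_derivative_of_real) (auto intro!: derivative_eq_intros simp: power2_eq_square)
      from has_vector_derivative_mult[OF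
          partial_snd_has_vector_derivative[OF differentiable_algD[OF assms(2)]] this]
      have "(?F has_vector_derivative a id (x, y) * of_real (- inverse (y\<^sup>2)) +
          frechet_derivative (a id) (at (x, y)) (0, 1) * of_real (inverse y)) (at y)" .
      moreover have "g (x, y) = a id (x, y) * of_real (- inverse (y\<^sup>2)) +
          frechet_derivative (a id) (at (x, y)) (0, 1) * of_real (inverse y)"
        using False unfolding g_def b_def alg_add_def alg_scale_def opY_eq[OF assms(2)]
        by (simp add: power2_eq_square field_simps)
      ultimately show ?thesis
        by simp
    next
      case True
      have 1: "open ((\<lambda>y. (x, y)) -` (- K))"
        using K(1) by (intro open_vimage continuous_intros) (simp add: compact_imp_closed open_Compl)
      have 2: "(x, 0) \<notin> K"
        using K(2) by (auto simp: Fplus_def)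
      have 3: "0 = ?F y" if "y \<in> (\<lambda>y. (x, y)) -` (- K)" for y
        using that K(3) by simp
      have "(?F has_vector_derivative 0) (at y)"
        unfolding True
        by (rule has_vector_derivative_transform_within_open[OF has_vector_derivative_const 1 _ 3])
          (simp_all add: 2)
      then show ?thesis
        by (simp add: True g_def)
    qed
    show "continuous_on UNIV (\<lambda>y. g (x, y))"
      by (rule continuous_on_compose2[OF Cc_continuous[OF g]]) (intro continuous_intros subset_UNIV)+
    show "?F y = 0" if "r \<le> \<bar>y\<bar>" for y
      using that r[of "(x, y)"] norm_snd_le[of y x] K(3)[of "(x, y)"] by force
    show "g (x, y) = 0" if "r \<le> \<bar>y\<bar>" for y
      using that r[of "(x, y)"] norm_snd_le[of y x] L(2)[of "(x, y)"] by force
  qed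
  then have "integral\<^sup>L lborel g = 0"
    unfolding lborel_integral_fst(2)[OF Cc_integrable[OF g]] by simp
  then have "tr b = 0"
    unfolding tr_eq[OF Cc_algebraD(3)[OF b]] g_def .
  then show ?thesis
    using tr_add[OF assms(3) Cc_algebra_scale[OF assms(1)], of "-1"] by (simp add: b_def tr_scale)
qed


subsection \<open>The product\<close>

text \<open>The level of the purely algebraic laws of the product: finiteness of the sums and
  invertibility of the indices in \<Gamma>.\<close>

definition finitely_supported :: "(real \<Rightarrow> real) set \<Rightarrow> alg \<Rightarrow> bool" where
  "finitely_supported \<Gamma> a \<longleftrightarrow> finite (supp a) \<and> supp a \<subseteq> \<Gamma>"

lemma Cc_algebra_finitely_supported: "a \<in> Cc_algebra \<Gamma> \<Longrightarrow> finitely_supported \<Gamma> a"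
  by (simp add: Cc_algebra_def finitely_supported_def)

lemma finitely_supported_mono: "finitely_supported \<Gamma> a \<Longrightarrow> supp b \<subseteq> supp a \<Longrightarrow> finitely_supported \<Gamma> b"
  unfolding finitely_supported_def using finite_subset by blast

lemma supp_opX: "supp (opX a) \<subseteq> supp a"
  unfolding supp_def using opX_zero by blast

lemma supp_opY: "supp (opY a) \<subseteq> supp a"
  unfolding supp_def using opY_zero by blast

lemma supp_delta1: "supp (delta1 a) \<subseteq> supp a"
  unfolding supp_def using delta1_zero by blast

lemma supp_alg_add: "supp (alg_add a b) \<subseteq> supp a \<union> supp b"
  by (auto simp: supp_def alg_add_def)

lemma supp_alg_scale: "supp (alg_scale c a) \<subseteq> supp a"
  by (auto simp: supp_def alg_scale_def)

lemma supp_star: "supp (a \<star> b) \<subseteq> (\<lambda>(\<phi>, \<psi>). \<psi> \<circ> \<phi>) ` (supp a \<times> supp b)"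
proof
  fix \<rho> assume "\<rho> \<in> supp (a \<star> b)"
  show "\<rho> \<in> (\<lambda>(\<phi>, \<psi>). \<psi> \<circ> \<phi>) ` (supp a \<times> supp b)"
  proof (rule ccontr)
    assume "\<rho> \<notin> (\<lambda>(\<phi>, \<psi>). \<psi> \<circ> \<phi>) ` (supp a \<times> supp b)"
    then have "\<psi> \<circ> \<phi> \<noteq> \<rho>" if "\<phi> \<in> supp a" "\<psi> \<in> supp b" for \<phi> \<psi>
      using that by auto
    then have "(a \<star> b) \<rho> = (\<lambda>_. 0)"
      by (simp add: alg_mult_def)
    then show False
      using \<open>\<rho> \<in> supp (a \<star> b)\<close> by (simp add: supp_def)
  qed
qed

context diffeo_group
begin

text \<open>The freedom in A allows several products to be expanded over one common index set and
  compared term by term.\<close>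

lemma star_eq:
  assumes "finite A" "supp a \<subseteq> A" "A \<subseteq> \<Gamma>" "finite (supp b)"
  shows "(a \<star> b) \<rho> p = (\<Sum>\<phi>\<in>A. a \<phi> p * b (\<rho> \<circ> inv_into UNIV \<phi>) (lift \<phi> p))"
proof -
  have inner: "(\<Sum>\<psi>\<in>supp b. if \<psi> \<circ> \<phi> = \<rho> then a \<phi> p * b \<psi> (lift \<phi> p) else 0) =
      a \<phi> p * b (\<rho> \<circ> inv_into UNIV \<phi>) (lift \<phi> p)" if "\<phi> \<in> \<Gamma>" for \<phi>
    using assms(4) that by (simp add: comp_eq_iff supp_zero)
  have "(a \<star> b) \<rho> p = (\<Sum>\<phi>\<in>supp a. a \<phi> p * b (\<rho> \<circ> inv_into UNIV \<phi>) (lift \<phi> p))"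
    unfolding alg_mult_def by (intro sum.cong refl inner) (use assms in auto)
  also have "\<dots> = (\<Sum>\<phi>\<in>A. a \<phi> p * b (\<rho> \<circ> inv_into UNIV \<phi>) (lift \<phi> p))"
    by (rule sum.mono_neutral_left) (use assms in \<open>auto simp: supp_zero\<close>)
  finally show ?thesis .
qed

text \<open>Intended for a' and b' obtained from a and b by X, Y, \<open>delta1\<close> or scaling,
  so that all terms of a Leibniz rule share one sum.\<close>

lemma star_eq_supp:
  assumes "finitely_supported \<Gamma> a" "finitely_supported \<Gamma> b" "supp a' \<subseteq> supp a" "supp b' \<subseteq> supp b"
  shows "(a' \<star> b') \<rho> p = (\<Sum>\<phi>\<in>supp a. a' \<phi> p * b' (\<rho> \<circ> inv_into UNIV \<phi>) (lift \<phi> p))"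
  using assms unfolding finitely_supported_def by (intro star_eq) (auto intro: finite_subset)

lemma products_diffeo:
  assumes "finitely_supported \<Gamma> a" "finitely_supported \<Gamma> b"
  shows "finite ((\<lambda>(\<phi>, \<psi>). \<psi> \<circ> \<phi>) ` (supp a \<times> supp b))" "(\<lambda>(\<phi>, \<psi>). \<psi> \<circ> \<phi>) ` (supp a \<times> supp b) \<subseteq> \<Gamma>"
  using assms by (auto simp: finitely_supported_def intro!: comp_diffeo)

lemma finitely_supported_star:
  assumes "finitely_supported \<Gamma> a" "finitely_supported \<Gamma> b"
  shows "finitely_supported \<Gamma> (a \<star> b)"
  unfolding finitely_supported_def
  by (intro conjI finite_subset[OF supp_star] subset_trans[OF supp_star] products_diffeo[OF assms])

lemma Cc_algebra_star:
  assumes "a \<in> Cc_algebra \<Gamma>" "b \<in> Cc_algebra \<Gamma>"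
  shows "a \<star> b \<in> Cc_algebra \<Gamma>"
proof -
  note fin = assms[THEN Cc_algebra_finitely_supported]
  have "(a \<star> b) \<rho> \<in> Cc" for \<rho>
  proof -
    have "(a \<star> b) \<rho> = (\<lambda>p. \<Sum>\<phi>\<in>supp a. a \<phi> p * b (\<rho> \<circ> inv_into UNIV \<phi>) (lift \<phi> p))"
      by (rule ext) (rule star_eq_supp[OF fin subset_refl subset_refl])
    moreover have "(\<lambda>p. a \<phi> p * b \<psi> (lift \<phi> p)) \<in> Cc" if "\<phi> \<in> supp a" for \<phi> \<psi>
    proof (rule Cc_mult[OF Cc_algebraD(3)[OF assms(1)]])
      have "\<phi> \<in> \<Gamma>"
        using that Cc_algebraD(2)[OF assms(1)] by blast
      then show "continuous_on Fplus (\<lambda>p. b \<psi> (lift \<phi> p))"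
        by (intro continuous_on_compose2[OF Cc_continuous[OF Cc_algebraD(3)[OF assms(2)]]]
            continuous_lift subset_UNIV)
    qed
    ultimately show ?thesis
      by (simp add: Cc_sum)
  qed
  then show ?thesis
    using finitely_supported_star[OF fin] by (auto simp: Cc_algebra_def finitely_supported_def)
qed

text \<open>Both sides run over pairs (\<phi>, \<psi>). The left side groups them by the composite
  \<sigma>; for fixed \<phi> the substitution \<sigma> = \<psi> \<circ> \<phi> undoes the
  grouping.\<close>

lemma star_assoc:
  assumes "finitely_supported \<Gamma> a" "finitely_supported \<Gamma> b" "finitely_supported \<Gamma> c"
  shows "(a \<star> b) \<star> c = a \<star> (b \<star> c)"
proof (intro ext)
  fix \<rho> p
  let ?i = "inv_into UNIV :: (real \<Rightarrow> real) \<Rightarrow> real \<Rightarrow> real"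
  let ?C = "(\<lambda>(\<phi>, \<psi>). \<psi> \<circ> \<phi>) ` (supp a \<times> supp b)"
  have \<Gamma>: "supp a \<subseteq> \<Gamma>" "supp b \<subseteq> \<Gamma>" "finite (supp a)" "finite (supp b)" "finite (supp c)"
    using assms by (auto simp: finitely_supported_def)
  have "((a \<star> b) \<star> c) \<rho> p = (\<Sum>\<sigma>\<in>?C. (a \<star> b) \<sigma> p * c (\<rho> \<circ> ?i \<sigma>) (lift \<sigma> p))"
    by (rule star_eq[OF products_diffeo(1)[OF assms(1,2)] supp_star products_diffeo(2)[OF assms(1,2)] \<Gamma>(5)])
  also have "\<dots> = (\<Sum>\<phi>\<in>supp a. \<Sum>\<sigma>\<in>?C.
      a \<phi> p * (b (\<sigma> \<circ> ?i \<phi>) (lift \<phi> p) * c (\<rho> \<circ> ?i \<sigma>) (lift \<sigma> p)))"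
    unfolding star_eq_supp[OF assms(1,2) subset_refl subset_refl] sum_distrib_right mult.assoc
    by (rule sum.swap)
  also have "\<dots> = (\<Sum>\<phi>\<in>supp a. a \<phi> p * (b \<star> c) (\<rho> \<circ> ?i \<phi>) (lift \<phi> p))"
  proof (rule sum.cong[OF refl])
    fix \<phi> assume \<phi>: "\<phi> \<in> supp a"
    then have \<phi>\<Gamma>: "\<phi> \<in> \<Gamma>"
      using \<Gamma> by auto
    have inj: "inj_on (\<lambda>\<psi>. \<psi> \<circ> \<phi>) (supp b)"
    proof (rule inj_onI)
      show "\<psi> = \<psi>'" if "\<psi> \<circ> \<phi> = \<psi>' \<circ> \<phi>" for \<psi> \<psi>'
        using that comp_eq_iff[OF \<phi>\<Gamma>, of \<psi> "\<psi>' \<circ> \<phi>"] comp_eq_iff[OF \<phi>\<Gamma>, of \<psi>' "\<psi>' \<circ> \<phi>"] by simp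
    qed
    \<comment> \<open>A composite \<sigma> that does not arise from this particular \<phi> meets a
      zero coefficient of b and drops out.\<close>
    have "(\<Sum>\<sigma>\<in>?C. a \<phi> p * (b (\<sigma> \<circ> ?i \<phi>) (lift \<phi> p) * c (\<rho> \<circ> ?i \<sigma>) (lift \<sigma> p))) =
      (\<Sum>\<sigma>\<in>(\<lambda>\<psi>. \<psi> \<circ> \<phi>) ` supp b. a \<phi> p * (b (\<sigma> \<circ> ?i \<phi>) (lift \<phi> p) * c (\<rho> \<circ> ?i \<sigma>) (lift \<sigma> p)))"
    proof (rule sum.mono_neutral_right)
      show "\<forall>\<sigma>\<in>?C - (\<lambda>\<psi>. \<psi> \<circ> \<phi>) ` supp b.
          a \<phi> p * (b (\<sigma> \<circ> ?i \<phi>) (lift \<phi> p) * c (\<rho> \<circ> ?i \<sigma>) (lift \<sigma> p)) = 0"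
      proof
        fix \<sigma> assume \<sigma>: "\<sigma> \<in> ?C - (\<lambda>\<psi>. \<psi> \<circ> \<phi>) ` supp b"
        have "(\<sigma> \<circ> ?i \<phi>) \<circ> \<phi> = \<sigma>"
          using comp_eq_iff[OF \<phi>\<Gamma>] by blast
        then have "\<sigma> \<circ> ?i \<phi> \<notin> supp b"
          using \<sigma> by (metis DiffD2 imageI)
        then show "a \<phi> p * (b (\<sigma> \<circ> ?i \<phi>) (lift \<phi> p) * c (\<rho> \<circ> ?i \<sigma>) (lift \<sigma> p)) = 0"
          by (simp add: supp_zero)
      qed
    qed (use \<phi> \<Gamma> in auto)
    also have "\<dots> = (\<Sum>\<psi>\<in>supp b. a \<phi> p *
        (b \<psi> (lift \<phi> p) * c ((\<rho> \<circ> ?i \<phi>) \<circ> ?i \<psi>) (lift \<psi> (lift \<phi> p))))"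
      unfolding sum.reindex[OF inj] o_def[of _ "\<lambda>\<psi>. \<psi> \<circ> \<phi>"]
    proof (rule sum.cong[OF refl])
      fix \<psi> assume "\<psi> \<in> supp b"
      then have \<psi>: "\<psi> \<in> \<Gamma>"
        using \<Gamma> by auto
      have "?i (\<psi> \<circ> \<phi>) = ?i \<phi> \<circ> ?i \<psi>"
        by (rule o_inv_distrib) (intro bij_diffeo \<psi> \<phi>\<Gamma>)+
      moreover have "(\<psi> \<circ> \<phi>) \<circ> ?i \<phi> = \<psi>"
        using comp_eq_iff[OF \<phi>\<Gamma>] by metis
      ultimately show "a \<phi> p * (b ((\<psi> \<circ> \<phi>) \<circ> ?i \<phi>) (lift \<phi> p) * c (\<rho> \<circ> ?i (\<psi> \<circ> \<phi>)) (lift (\<psi> \<circ> \<phi>) p)) =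
          a \<phi> p * (b \<psi> (lift \<phi> p) * c ((\<rho> \<circ> ?i \<phi>) \<circ> ?i \<psi>) (lift \<psi> (lift \<phi> p)))"
        by (simp only: lift_comp[OF \<psi> \<phi>\<Gamma>] comp_assoc)
    qed
    also have "\<dots> = a \<phi> p * (b \<star> c) (\<rho> \<circ> ?i \<phi>) (lift \<phi> p)"
      by (simp only: star_eq_supp[OF assms(2,3) subset_refl subset_refl] sum_distrib_left)
    finally show "(\<Sum>\<sigma>\<in>?C. a \<phi> p * (b (\<sigma> \<circ> ?i \<phi>) (lift \<phi> p) * c (\<rho> \<circ> ?i \<sigma>) (lift \<sigma> p))) =
        a \<phi> p * (b \<star> c) (\<rho> \<circ> ?i \<phi>) (lift \<phi> p)" .
  qed
  also have "\<dots> = (a \<star> (b \<star> c)) \<rho> p"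
    by (rule star_eq_supp[symmetric, OF assms(1) finitely_supported_star[OF assms(2,3)]]) auto
  finally show "((a \<star> b) \<star> c) \<rho> p = (a \<star> (b \<star> c)) \<rho> p" .
qed

lemma star_add_left:
  assumes "finitely_supported \<Gamma> a" "finitely_supported \<Gamma> b" "finitely_supported \<Gamma> c"
  shows "alg_add a b \<star> c = alg_add (a \<star> c) (b \<star> c)"
proof (intro ext)
  fix \<rho> p
  have *: "finite (supp a \<union> supp b)" "supp a \<union> supp b \<subseteq> \<Gamma>" "finite (supp c)"
    using assms by (auto simp: finitely_supported_def)
  show "(alg_add a b \<star> c) \<rho> p = alg_add (a \<star> c) (b \<star> c) \<rho> p"
    unfolding alg_add_def[of "a \<star> c"] star_eq[OF *(1) supp_alg_add *(2,3)]
      star_eq[OF *(1) Un_upper1 *(2,3)] star_eq[OF *(1) Un_upper2 *(2,3)]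
    by (simp add: alg_add_def distrib_right sum.distrib)
qed

lemma star_add_right:
  assumes "finitely_supported \<Gamma> a" "finitely_supported \<Gamma> b" "finitely_supported \<Gamma> c"
  shows "a \<star> alg_add b c = alg_add (a \<star> b) (a \<star> c)"
proof (intro ext)
  fix \<rho> p
  have *: "finite (supp a)" "supp a \<subseteq> \<Gamma>" "finite (supp b)" "finite (supp c)"
    using assms by (auto simp: finitely_supported_def)
  then have "finite (supp (alg_add b c))"
    by (auto intro: finite_subset[OF supp_alg_add])
  then show "(a \<star> alg_add b c) \<rho> p = alg_add (a \<star> b) (a \<star> c) \<rho> p"
    using * by (simp add: alg_add_def[of "a \<star> b"] star_eq[OF *(1) subset_refl *(2)])
      (simp add: alg_add_def distrib_left sum.distrib)
qed

lemma star_scale_left: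
  assumes "finitely_supported \<Gamma> a" "finitely_supported \<Gamma> b"
  shows "alg_scale c a \<star> b = alg_scale c (a \<star> b)"
proof (intro ext)
  fix \<rho> p
  show "(alg_scale c a \<star> b) \<rho> p = alg_scale c (a \<star> b) \<rho> p"
    unfolding alg_scale_def[of c "a \<star> b"] star_eq_supp[OF assms supp_alg_scale subset_refl]
      star_eq_supp[OF assms subset_refl subset_refl]
    by (simp add: alg_scale_def sum_distrib_left mult.assoc)
qed

lemma star_scale_right:
  assumes "finitely_supported \<Gamma> a" "finitely_supported \<Gamma> b"
  shows "a \<star> alg_scale c b = alg_scale c (a \<star> b)"
proof (intro ext)
  fix \<rho> p
  show "(a \<star> alg_scale c b) \<rho> p = alg_scale c (a \<star> b) \<rho> p"
    unfolding alg_scale_def[of c "a \<star> b"] star_eq_supp[OF assms subset_refl supp_alg_scale]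
      star_eq_supp[OF assms subset_refl subset_refl]
    by (simp add: alg_scale_def sum_distrib_left mult.left_commute)
qed

lemma tr_star_commute:
  assumes "a \<in> Cc_algebra \<Gamma>" "b \<in> Cc_algebra \<Gamma>"
  shows "tr (a \<star> b) = tr (b \<star> a)"
proof -
  let ?i = "inv_into UNIV :: (real \<Rightarrow> real) \<Rightarrow> real \<Rightarrow> real"
  \<comment> \<open>The coefficient at \<open>id\<close> pairs each \<phi> with its inverse. This A
    contains the support of a, and its image under inversion contains that of b, so both products
    can be summed over matching indices.\<close>
  define A where "A = supp a \<union> ?i ` supp b"
  have A: "finite A" "supp a \<subseteq> A" "A \<subseteq> \<Gamma>"
    using Cc_algebraD[OF assms(1)] Cc_algebraD[OF assms(2)] inv_diffeo by (auto simp: A_def)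
  have ii: "?i (?i \<phi>) = \<phi>" if "\<phi> \<in> \<Gamma>" for \<phi>
    using that by (simp add: bij_diffeo inv_inv_eq)
  have B: "finite (?i ` A)" "supp b \<subseteq> ?i ` A" "?i ` A \<subseteq> \<Gamma>"
  proof -
    show "supp b \<subseteq> ?i ` A"
    proof
      fix \<psi> assume "\<psi> \<in> supp b"
      then show "\<psi> \<in> ?i ` A"
        using ii[of \<psi>] Cc_algebraD(2)[OF assms(2)] unfolding A_def by (metis UnI2 imageI subsetD)
    qed
  qed (use A inv_diffeo in auto)
  define f where "f = (\<lambda>\<phi> p. a \<phi> p * b (?i \<phi>) (lift \<phi> p) / of_real ((snd p)\<^sup>2))"
  define g where "g = (\<lambda>\<phi> p. b (?i \<phi>) p * a \<phi> (lift (?i \<phi>) p) / of_real ((snd p)\<^sup>2))"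
  have f: "f \<phi> \<in> Cc" and g: "g \<phi> \<in> Cc" if "\<phi> \<in> A" for \<phi>
  proof -
    have "\<phi> \<in> \<Gamma>"
      using that A by auto
    then have "continuous_on Fplus (\<lambda>p. b (?i \<phi>) (lift \<phi> p))"
      "continuous_on Fplus (\<lambda>p. a \<phi> (lift (?i \<phi>) p))"
      by (auto intro!: continuous_lift inv_diffeo
          continuous_on_compose2[OF Cc_continuous[OF Cc_algebraD(3)[OF assms(1)]]]
          continuous_on_compose2[OF Cc_continuous[OF Cc_algebraD(3)[OF assms(2)]]])
    then show "f \<phi> \<in> Cc" "g \<phi> \<in> Cc"
      unfolding f_def g_def
      using Cc_mult[OF Cc_algebraD(3)[OF assms(1)]] Cc_mult[OF Cc_algebraD(3)[OF assms(2)]] Cc_weight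
      by blast+
  qed
  have fg: "integral\<^sup>L lborel (f \<phi>) = integral\<^sup>L lborel (g \<phi>)" if \<phi>A: "\<phi> \<in> A" for \<phi>
  proof -
    have \<phi>: "\<phi> \<in> \<Gamma>"
      using \<phi>A A by auto
    \<comment> \<open>At \<open>lift \<phi> p\<close> the weight is y^-2 divided by \<phi>'^2, which
      the Jacobian restores.\<close>
    have "f \<phi> p = (deriv \<phi> (fst p))\<^sup>2 *\<^sub>R g \<phi> (lift \<phi> p)" for p
    proof -
      have "snd (lift \<phi> p) = deriv \<phi> (fst p) * snd p"
        by (simp add: lift_def split: prod.splits)
      then show ?thesis
        using diffeo_deriv_nonzero[OF \<phi>, of "fst p"]
        by (simp add: f_def g_def lift_inv[OF \<phi>] scaleR_conv_of_real power_mult_distrib mult.commute)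
    qed
    then have "f \<phi> = (\<lambda>p. (deriv \<phi> (fst p))\<^sup>2 *\<^sub>R g \<phi> (lift \<phi> p))"
      by blast
    moreover obtain K where "compact K" "\<And>p. p \<notin> K \<Longrightarrow> g \<phi> p = 0"
      using g[OF \<phi>A] by (rule Cc_support) blast
    ultimately show ?thesis
      using integral_lift[OF \<phi> Cc_continuous[OF g[OF \<phi>A]]] by simp
  qed
  have "tr (a \<star> b) = (LINT p|lborel. (\<Sum>\<phi>\<in>A. f \<phi> p))"
    unfolding tr_eq[OF Cc_algebraD(3)[OF Cc_algebra_star[OF assms]]]
      star_eq[OF A Cc_algebraD(1)[OF assms(2)]] f_def
    by (simp add: sum_divide_distrib)
  also have "\<dots> = (\<Sum>\<phi>\<in>A. integral\<^sup>L lborel (f \<phi>))"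
    by (intro Bochner_Integration.integral_sum Cc_integrable f)
  also have "\<dots> = (\<Sum>\<phi>\<in>A. integral\<^sup>L lborel (g \<phi>))"
    by (intro sum.cong refl fg)
  also have "\<dots> = (LINT p|lborel. (\<Sum>\<phi>\<in>A. g \<phi> p))"
    by (intro Bochner_Integration.integral_sum[symmetric] Cc_integrable g)
  also have "\<dots> = tr (b \<star> a)"
  proof -
    have inj: "inj_on ?i A"
      by (rule inj_on_inverseI[of A ?i]) (use ii A(3) in blast)
    have "(b \<star> a) id p = (\<Sum>\<phi>\<in>A. b (?i \<phi>) p * a \<phi> (lift (?i \<phi>) p))" for p
      unfolding star_eq[OF B Cc_algebraD(1)[OF assms(1)]] sum.reindex[OF inj] o_def[of _ ?i] id_comp
      using ii A(3) by (intro sum.cong) auto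
    then show ?thesis
      unfolding tr_eq[OF Cc_algebraD(3)[OF Cc_algebra_star[OF assms(2,1)]]] g_def
      by (simp add: sum_divide_distrib)
  qed
  finally show ?thesis .
qed


subsection \<open>Leibniz rules\<close>

text \<open>The derivative of g is split along the coordinate directions, so that X and Y of the
  second factor can be recognised after setting v = (1, 0) or v = (0, 1).\<close>

lemma mult_lift_has_derivative:
  fixes f g :: "real \<times> real \<Rightarrow> complex"
  assumes "\<phi> \<in> \<Gamma>" "f differentiable (at p)" "g differentiable (at (lift \<phi> p))"
  defines "g' \<equiv> frechet_derivative g (at (lift \<phi> p))"
  shows "((\<lambda>p. f p * g (lift \<phi> p)) has_derivative
    (\<lambda>v. f p * (of_real (deriv \<phi> (fst p) * fst v) * g' (1, 0) +
        of_real (deriv (deriv \<phi>) (fst p) * snd p * fst v + deriv \<phi> (fst p) * snd v) * g' (0, 1)) +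
      frechet_derivative f (at p) v * g (lift \<phi> p))) (at p)"
proof -
  have g': "(g has_derivative g') (at (lift \<phi> p))"
    unfolding g'_def by (rule differentiable_has_derivative[OF assms(3)])
  have lin: "g' (s, t) = of_real s * g' (1, 0) + of_real t * g' (0, 1)" for s t
  proof -
    have "g' (s *\<^sub>R (1, 0) + t *\<^sub>R (0, 1)) = s *\<^sub>R g' (1, 0) + t *\<^sub>R g' (0, 1)"
      using has_derivative_linear[OF g'] by (simp only: linear_add linear_scale)
    then show ?thesis
      by (simp add: scaleR_conv_of_real)
  qed
  show ?thesis
    using has_derivative_mult[OF differentiable_has_derivative[OF assms(2)]
        has_derivative_compose[OF lift_has_derivative[OF assms(1)] g']]
    by (subst (asm) lin)
qed

lemma star_has_derivative:
  assumes "finitely_supported \<Gamma> a" "finitely_supported \<Gamma> b" "differentiable_alg a" "differentiable_alg b"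
  shows "((a \<star> b) \<rho> has_derivative (\<lambda>v. \<Sum>\<phi>\<in>supp a.
      a \<phi> p * (of_real (deriv \<phi> (fst p) * fst v) *
          frechet_derivative (b (\<rho> \<circ> inv_into UNIV \<phi>)) (at (lift \<phi> p)) (1, 0) +
        of_real (deriv (deriv \<phi>) (fst p) * snd p * fst v + deriv \<phi> (fst p) * snd v) *
          frechet_derivative (b (\<rho> \<circ> inv_into UNIV \<phi>)) (at (lift \<phi> p)) (0, 1)) +
      frechet_derivative (a \<phi>) (at p) v * b (\<rho> \<circ> inv_into UNIV \<phi>) (lift \<phi> p))) (at p)"
proof -
  have "(a \<star> b) \<rho> = (\<lambda>p. \<Sum>\<phi>\<in>supp a. a \<phi> p * b (\<rho> \<circ> inv_into UNIV \<phi>) (lift \<phi> p))"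
    by (rule ext) (rule star_eq_supp[OF assms(1,2) subset_refl subset_refl])
  then show ?thesis
    using assms(1)
    by (simp only:, intro has_derivative_sum mult_lift_has_derivative differentiable_algD[OF assms(3)]
        differentiable_algD[OF assms(4)]) (auto simp: finitely_supported_def)
qed

lemma differentiable_star:
  assumes "finitely_supported \<Gamma> a" "finitely_supported \<Gamma> b" "differentiable_alg a" "differentiable_alg b"
  shows "differentiable_alg (a \<star> b)"
  unfolding differentiable_alg_def using star_has_derivative[OF assms] differentiable_def by blast

text \<open>The term \<open>\<delta>\<^sub>1(a) Y(b)\<close> comes from the off-diagonal entry \<open>\<phi>''(x) y\<close> of the Jacobian of \<^term>\<open>lift \<phi>\<close>.\<close>

lemma opX_star:
  assumes "finitely_supported \<Gamma> a" "finitely_supported \<Gamma> b" "differentiable_alg a" "differentiable_alg b"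
  shows "opX (a \<star> b) = alg_add (alg_add (opX a \<star> b) (a \<star> opX b)) (delta1 a \<star> opY b)"
proof (intro ext)
  fix \<rho> p
  have snd_lift: "snd (lift \<phi> p) = deriv \<phi> (fst p) * snd p" for \<phi>
    by (simp add: lift_def split: prod.splits)
  have delta1: "delta1 a \<phi> p =
      of_real (snd p * (deriv (deriv \<phi>) (fst p) / deriv \<phi> (fst p))) * a \<phi> p" for \<phi>
    by (simp add: delta1_def split: prod.splits)
  show "opX (a \<star> b) \<rho> p = alg_add (alg_add (opX a \<star> b) (a \<star> opX b)) (delta1 a \<star> opY b) \<rho> p"
    unfolding alg_add_def star_eq_supp[OF assms(1,2) supp_opX subset_refl]
      star_eq_supp[OF assms(1,2) subset_refl supp_opX] star_eq_supp[OF assms(1,2) supp_delta1 supp_opY]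
      opX_eq[OF differentiable_star[OF assms]] frechet_derivative_at_eq[OF star_has_derivative[OF assms]]
      opX_eq[OF assms(3)] opX_eq[OF assms(4)] opY_eq[OF assms(4)] snd_lift delta1
      sum_distrib_left sum.distrib[symmetric]
  proof (rule sum.cong[OF refl])
    fix \<phi> assume "\<phi> \<in> supp a"
    \<comment> \<open>The denominator in \<open>delta1\<close> cancels the factor \<phi>' that Y(b)
      receives from the second coordinate of the lift.\<close>
    then have "deriv \<phi> (fst p) \<noteq> 0"
      using assms(1) diffeo_deriv_nonzero by (auto simp: finitely_supported_def)
    then show "of_real (snd p) *
        (a \<phi> p * (of_real (deriv \<phi> (fst p) * fst (1, 0)) *
            frechet_derivative (b (\<rho> \<circ> inv_into UNIV \<phi>)) (at (lift \<phi> p)) (1, 0) +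
          of_real (deriv (deriv \<phi>) (fst p) * snd p * fst (1, 0) + deriv \<phi> (fst p) * snd (1, 0)) *
            frechet_derivative (b (\<rho> \<circ> inv_into UNIV \<phi>)) (at (lift \<phi> p)) (0, 1)) +
        frechet_derivative (a \<phi>) (at p) (1, 0) * b (\<rho> \<circ> inv_into UNIV \<phi>) (lift \<phi> p)) =
      of_real (snd p) * frechet_derivative (a \<phi>) (at p) (1, 0) * b (\<rho> \<circ> inv_into UNIV \<phi>) (lift \<phi> p) +
      a \<phi> p * (of_real (deriv \<phi> (fst p) * snd p) *
        frechet_derivative (b (\<rho> \<circ> inv_into UNIV \<phi>)) (at (lift \<phi> p)) (1, 0)) +
      of_real (snd p * (deriv (deriv \<phi>) (fst p) / deriv \<phi> (fst p))) * a \<phi> p *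
        (of_real (deriv \<phi> (fst p) * snd p) *
        frechet_derivative (b (\<rho> \<circ> inv_into UNIV \<phi>)) (at (lift \<phi> p)) (0, 1))"
      by (simp add: field_simps)
  qed
qed

text \<open>Lifts commute with the dilations in y, which Y generates; hence there is no defect
  term.\<close>

lemma opY_star:
  assumes "finitely_supported \<Gamma> a" "finitely_supported \<Gamma> b" "differentiable_alg a" "differentiable_alg b"
  shows "opY (a \<star> b) = alg_add (opY a \<star> b) (a \<star> opY b)"
proof (intro ext)
  fix \<rho> p
  have snd_lift: "snd (lift \<phi> p) = deriv \<phi> (fst p) * snd p" for \<phi>
    by (simp add: lift_def split: prod.splits)
  show "opY (a \<star> b) \<rho> p = alg_add (opY a \<star> b) (a \<star> opY b) \<rho> p"
    unfolding alg_add_def star_eq_supp[OF assms(1,2) supp_opY subset_refl]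
      star_eq_supp[OF assms(1,2) subset_refl supp_opY]
      opY_eq[OF differentiable_star[OF assms]] frechet_derivative_at_eq[OF star_has_derivative[OF assms]]
      opY_eq[OF assms(3)] opY_eq[OF assms(4)] snd_lift sum_distrib_left sum.distrib[symmetric]
    by (rule sum.cong[OF refl]) (simp add: algebra_simps)
qed

text \<open>The cocycle identity for \<phi>''/\<phi>' has a factor \<phi>' in its first summand;
  here it is supplied by the second coordinate \<phi>' y of the lift.\<close>

lemma delta1_star:
  assumes "finitely_supported \<Gamma> a" "finitely_supported \<Gamma> b"
  shows "delta1 (a \<star> b) = alg_add (delta1 a \<star> b) (a \<star> delta1 b)"
proof (intro ext)
  fix \<rho> p
  let ?i = "inv_into UNIV :: (real \<Rightarrow> real) \<Rightarrow> real \<Rightarrow> real"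
  have delta1: "delta1 f \<phi> q =
      of_real (snd q * (deriv (deriv \<phi>) (fst q) / deriv \<phi> (fst q))) * f \<phi> q" for f \<phi> q
    by (simp add: delta1_def split: prod.splits)
  have lift: "fst (lift \<phi> p) = \<phi> (fst p)" "snd (lift \<phi> p) = deriv \<phi> (fst p) * snd p" for \<phi>
    by (simp_all add: lift_def split: prod.splits)
  show "delta1 (a \<star> b) \<rho> p = alg_add (delta1 a \<star> b) (a \<star> delta1 b) \<rho> p"
    unfolding alg_add_def star_eq_supp[OF assms supp_delta1 subset_refl]
      star_eq_supp[OF assms subset_refl supp_delta1]
      delta1[of "a \<star> b"] star_eq_supp[OF assms subset_refl subset_refl]
      sum_distrib_left sum.distrib[symmetric]
  proof (rule sum.cong[OF refl])
    fix \<phi> assume "\<phi> \<in> supp a"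
    then have \<phi>: "\<phi> \<in> \<Gamma>"
      using assms(1) by (auto simp: finitely_supported_def)
    define \<psi> where "\<psi> = \<rho> \<circ> ?i \<phi>"
    have \<rho>: "\<rho> = \<psi> \<circ> \<phi>"
      using comp_eq_iff[OF \<phi>, of \<psi> \<rho>] by (simp add: \<psi>_def)
    have "of_real (snd p * (deriv (deriv \<rho>) (fst p) / deriv \<rho> (fst p))) * (a \<phi> p * b \<psi> (lift \<phi> p)) =
        delta1 a \<phi> p * b \<psi> (lift \<phi> p) + a \<phi> p * delta1 b \<psi> (lift \<phi> p)"
    \<comment> \<open>The index \<rho> is arbitrary, so \<psi> may lie outside \<Gamma>, where no
      chain rule is at hand; then the coefficient of b is zero.\<close>
    proof (cases "\<psi> \<in> \<Gamma>")
      case True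
      then show ?thesis
        using diffeo_deriv_nonzero[OF \<phi>, of "fst p"] diffeo_deriv_nonzero[OF True, of "\<phi> (fst p)"]
        unfolding \<rho> deriv_deriv_comp_diffeo[OF True \<phi>]
        unfolding deriv_comp_diffeo[OF True \<phi>] delta1 lift
        by (simp add: field_simps power2_eq_square)
    next
      case False
      then have "b \<psi> = (\<lambda>_. 0)"
        using assms(2) by (intro supp_zero) (auto simp: finitely_supported_def)
      then show ?thesis
        by (simp add: delta1_zero)
    qed
    then show "of_real (snd p * (deriv (deriv \<rho>) (fst p) / deriv \<rho> (fst p))) *
        (a \<phi> p * b (\<rho> \<circ> ?i \<phi>) (lift \<phi> p)) =
        delta1 a \<phi> p * b (\<rho> \<circ> ?i \<phi>) (lift \<phi> p) + a \<phi> p * delta1 b (\<rho> \<circ> ?i \<phi>) (lift \<phi> p)"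
      by (simp only: \<psi>_def)
  qed
qed

lemma delta1_factor_differentiable:
  assumes "\<phi> \<in> \<Gamma>"
  shows "(\<lambda>p. complex_of_real (snd p * (deriv (deriv \<phi>) (fst p) / deriv \<phi> (fst p)))) differentiable (at q)"
proof -
  have "deriv \<phi> differentiable (at x)" for x
    using diffeo_deriv_deriv[OF assms] real_differentiable_def by blast
  then have "(\<lambda>x. deriv (deriv \<phi>) x / deriv \<phi> x) differentiable (at x)" for x
    by (intro differentiable_divide diffeo_deriv_nonzero assms
        smooth_on_differentiable[OF smooth_deriv_deriv[OF assms] UNIV_I])
  then have "(\<lambda>p. deriv (deriv \<phi>) (fst p) / deriv \<phi> (fst p)) differentiable (at q)"
    by (rule differentiable_compose[OF _ bounded_linear_imp_differentiable[OF bounded_linear_fst]])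
  then have "(\<lambda>p. snd p * (deriv (deriv \<phi>) (fst p) / deriv \<phi> (fst p))) differentiable (at q)"
    by (intro differentiable_mult bounded_linear_imp_differentiable[OF bounded_linear_snd])
  then show ?thesis
    using differentiable_compose[OF bounded_linear_imp_differentiable[OF bounded_linear_of_real]] by blast
qed

lemma differentiable_delta1:
  assumes "finitely_supported \<Gamma> a" "differentiable_alg a"
  shows "differentiable_alg (delta1 a)"
  unfolding differentiable_alg_def
proof (intro allI)
  fix \<phi> p
  show "delta1 a \<phi> differentiable (at p)"
  \<comment> \<open>Outside \<Gamma> the factor \<phi>''/\<phi>' is uncontrolled, but there the
    coefficient vanishes.\<close>
  proof (cases "\<phi> \<in> \<Gamma>")
    case True
    have "delta1 a \<phi> =
        (\<lambda>p. of_real (snd p * (deriv (deriv \<phi>) (fst p) / deriv \<phi> (fst p))) * a \<phi> p)"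
      by (auto simp: delta1_def)
    then show ?thesis
      using differentiable_mult[OF delta1_factor_differentiable[OF True] differentiable_algD[OF assms(2)]]
      by simp
  next
    case False
    then have "delta1 a \<phi> = (\<lambda>_. 0)"
      using assms(1) by (intro delta1_zero supp_zero) (auto simp: finitely_supported_def)
    then show ?thesis
      by simp
  qed
qed

lemma Cc_algebra_delta1:
  assumes "a \<in> Cc_algebra \<Gamma>"
  shows "delta1 a \<in> Cc_algebra \<Gamma>"
proof -
  have "delta1 a \<phi> \<in> Cc" for \<phi>
  proof (cases "\<phi> \<in> \<Gamma>")
    case True
    have "delta1 a \<phi> =
        (\<lambda>p. a \<phi> p * of_real (snd p * (deriv (deriv \<phi>) (fst p) / deriv \<phi> (fst p))))"
      by (auto simp: delta1_def)
    moreover have "continuous_on Fplus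
        (\<lambda>p. complex_of_real (snd p * (deriv (deriv \<phi>) (fst p) / deriv \<phi> (fst p))))"
      by (intro continuous_at_imp_continuous_on ballI differentiable_imp_continuous_within
          delta1_factor_differentiable True)
    ultimately show ?thesis
      by (simp only: Cc_mult[OF Cc_algebraD(3)[OF assms]])
  next
    case False
    then have "delta1 a \<phi> = (\<lambda>_. 0)"
      using Cc_algebraD(2)[OF assms] by (intro delta1_zero supp_zero) auto
    then show ?thesis
      by (simp add: Cc_zero)
  qed
  then show ?thesis
    using finitely_supported_mono[OF Cc_algebra_finitely_supported[OF assms] supp_delta1]
    by (auto simp: Cc_algebra_def finitely_supported_def)
qed

end


subsection \<open>The cochain \<open>\<phi>\<^sub>0 - \<phi>\<^sub>1\<close>\<close>

text \<open>The substitution Y -> -Y is an involution.\<close>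

lemma inv_antipode: "inv_into UNIV antipode k = antipode k"
proof -
  have "antipode (antipode p) = p" for p
  proof -
    have "antipode (antipode p) = pcompose p (pcompose [:0, -1:] [:0, -1:])"
      unfolding antipode_def by (rule pcompose_assoc[symmetric])
    then show ?thesis
      by (simp add: pcompose_pCons)
  qed
  then have "inv_into UNIV antipode (antipode (antipode k)) = antipode k"
    by (intro inv_into_f_f inj_on_inverseI[of _ antipode]) auto
  then show ?thesis
    by (simp add: \<open>\<And>p. antipode (antipode p) = p\<close>)
qed

section \<open>Action and coproduct of C[Y], and a criterion for equivariance\<close>

lemma act_monom: "act (monom c n) a = alg_scale c ((opY ^^ n) a)"
proof (cases "c = 0")
  case True
  then show ?thesis
    by (simp add: act_def alg_scale_def)
next
  case False
  then show ?thesis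
    by (auto simp: act_def alg_scale_def fun_eq_iff degree_monom_eq sum.delta if_distrib[of "\<lambda>x. x * _"]
        cong: if_cong)
qed

lemma act_1: "act 1 a = a"
  by (simp add: act_def)

lemma act_antipode_Y: "act (antipode [:0, 1:]) a = alg_scale (-1) (opY a)"
  by (simp add: act_def antipode_def pcompose_pCons alg_scale_def atMost_Suc)

lemma crossed_opY_power: "a \<in> crossed_algebra \<Gamma> \<Longrightarrow> (opY ^^ n) a \<in> crossed_algebra \<Gamma>"
  by (induction n) (auto intro: crossed_opY)

lemma counit_monom: "counit (monom c n) = c * 0 ^ n"
  by (simp add: counit_def poly_monom)

lemma sum_list_concat: "sum_list (concat xss) = (\<Sum>xs\<leftarrow>xss. sum_list xs)"
  by (induction xss) auto

text \<open>Passes from the list of simple tensors to a finite double sum, in which binomial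
  identities can be used.\<close>

lemma sum_coproduct:
  "(\<Sum>(k1, k2)\<leftarrow>coproduct k. F k1 k2) =
    (\<Sum>n\<le>degree k. \<Sum>i\<le>n. F (monom (coeff k n * of_nat (n choose i)) i) (monom 1 (n - i)))"
proof -
  have "(\<Sum>(k1, k2)\<leftarrow>coproduct k. F k1 k2) =
    (\<Sum>n\<leftarrow>[0..<Suc (degree k)]. \<Sum>i\<leftarrow>[0..<Suc n].
      F (monom (coeff k n * of_nat (n choose i)) i) (monom 1 (n - i)))"
    unfolding coproduct_def map_concat sum_list_concat map_map o_def prod.case ..
  then show ?thesis
    by (simp only: interv_sum_list_conv_sum_set_nat atLeast0LessThan lessThan_Suc_atMost set_upt)
qed

lemma diag_eval_Cons:
  "diag_eval k (a # as) G = (\<Sum>n\<le>degree k. \<Sum>i\<le>n.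
    diag_eval (monom 1 (n - i)) as (\<lambda>bs. G (act (monom (coeff k n * of_nat (n choose i)) i) a # bs)))"
  by (simp only: diag_eval.simps sum_coproduct)

lemma diag_eval_mult: "diag_eval k as (\<lambda>bs. c * G bs) = c * diag_eval k as G"
proof (induction as arbitrary: k G)
  case (Cons a as)
  then show ?case
    by (simp only: diag_eval_Cons sum_distrib_left)
qed simp

text \<open>Powers of 0 are the values of the counit on powers of Y. This sum and the next one
  express the counit axioms on the two legs of the coproduct.\<close>

lemma sum_top_power_zero:
  fixes f :: "nat \<Rightarrow> 'a::comm_semiring_1"
  shows "(\<Sum>i\<le>n. 0 ^ (n - i) * f i) = f n"
  by (subst sum.remove[of _ n]) (auto intro!: sum.neutral simp: power_0_left)

lemma sum_bot_power_zero:
  fixes f :: "nat \<Rightarrow> 'a::comm_semiring_1"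
  shows "(\<Sum>i\<le>n. 0 ^ i * f i) = f 0"
  by (subst sum.remove[of _ 0]) (auto intro!: sum.neutral simp: power_0_left)

lemma alg_tuples_1E:
  assumes "as \<in> alg_tuples \<Gamma> 1"
  obtains a b where "as = [a, b]" "a \<in> crossed_algebra \<Gamma>" "b \<in> crossed_algebra \<Gamma>"
  using assms by (auto simp: alg_tuples_def length_Suc_conv numeral_2_eq_2)

text \<open>As \<open>\<Phi>(Y a, b) = - \<Phi>(a, Y b)\<close>, the action of \<open>Y\<^sup>n\<close> produces the alternating sum of the
  binomial coefficients times \<open>\<Phi>(a, Y\<^sup>n b)\<close>.\<close>

lemma equivariant_1I:
  assumes V: "\<And>c v as. \<Phi> (V_scale c v) as = c * \<Phi> v as"
    and scale: "\<And>v a b c d. a \<in> crossed_algebra \<Gamma> \<Longrightarrow> b \<in> crossed_algebra \<Gamma> \<Longrightarrow>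
      \<Phi> v [alg_scale c a, alg_scale d b] = c * d * \<Phi> v [a, b]"
    and Y: "\<And>v a b. a \<in> crossed_algebra \<Gamma> \<Longrightarrow> b \<in> crossed_algebra \<Gamma> \<Longrightarrow>
      \<Phi> v [opY a, b] = - \<Phi> v [a, opY b]"
  shows "equivariant \<Gamma> 1 \<Phi>"
  unfolding equivariant_def
proof (intro allI ballI)
  fix k v as
  assume "as \<in> alg_tuples \<Gamma> 1"
  then obtain a b where as: "as = [a, b]" and ab: "a \<in> crossed_algebra \<Gamma>" "b \<in> crossed_algebra \<Gamma>"
    by (rule alg_tuples_1E)
  \<comment> \<open>All powers of Y are collected on b at the price of a sign, leaving an expression
    in which only binomial coefficients depend on i.\<close>
  have move: "\<Phi> v [(opY ^^ i) a, (opY ^^ j) b] = (-1) ^ i * \<Phi> v [a, (opY ^^ (i + j)) b]" for i j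
  proof (induction i arbitrary: j)
    case (Suc i)
    have "\<Phi> v [(opY ^^ Suc i) a, (opY ^^ j) b] = - \<Phi> v [(opY ^^ i) a, (opY ^^ Suc j) b]"
      using Y[OF crossed_opY_power[OF ab(1), of i] crossed_opY_power[OF ab(2), of j]] by simp
    then show ?case
      using Suc.IH[of "Suc j"] by simp
  qed simp
  \<comment> \<open>After the last entry \<open>diag_eval\<close> applies the counit to the
    remaining leg, so only the term in which the full power acts on b is left.\<close>
  have single: "diag_eval (monom 1 j) [b] (\<lambda>bs. \<Phi> v (alg_scale c ((opY ^^ i) a) # bs)) =
      c * \<Phi> v [(opY ^^ i) a, (opY ^^ j) b]" for c i j
  proof -
    have "diag_eval (monom 1 j) [b] (\<lambda>bs. \<Phi> v (alg_scale c ((opY ^^ i) a) # bs)) =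
      (\<Sum>n\<le>j. \<Sum>m\<le>n. 0 ^ (n - m) * (c * (coeff (monom 1 j) n * of_nat (n choose m)) *
        \<Phi> v [(opY ^^ i) a, (opY ^^ m) b]))"
      unfolding diag_eval_Cons diag_eval.simps counit_monom act_monom
        scale[OF crossed_opY_power[OF ab(1)] crossed_opY_power[OF ab(2)]]
      by (simp add: degree_monom_eq)
    also have "\<dots> = (\<Sum>n\<le>j. if n = j then c * \<Phi> v [(opY ^^ i) a, (opY ^^ n) b] else 0)"
      unfolding sum_top_power_zero by (intro sum.cong) auto
    finally show ?thesis
      by simp
  qed
  have power: "diag_eval (monom 1 n) as (\<Phi> v) = 0 ^ n * \<Phi> v as" for n
  proof -
    have "diag_eval (monom 1 n) as (\<Phi> v) = (\<Sum>m\<le>n. \<Sum>i\<le>m.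
        coeff (monom 1 n) m * of_nat (m choose i) * \<Phi> v [(opY ^^ i) a, (opY ^^ (m - i)) b])"
      unfolding as diag_eval_Cons[of _ a] act_monom single by (simp add: degree_monom_eq)
    also have "\<dots> = (\<Sum>m\<le>n. if m = n then
        (\<Sum>i\<le>m. of_nat (m choose i) * \<Phi> v [(opY ^^ i) a, (opY ^^ (m - i)) b]) else 0)"
      by (intro sum.cong) auto
    also have "\<dots> = (\<Sum>i\<le>n. of_nat (n choose i) * \<Phi> v [(opY ^^ i) a, (opY ^^ (n - i)) b])"
      by simp
    also have "\<dots> = (\<Sum>i\<le>n. (-1) ^ i * of_nat (n choose i) * \<Phi> v [a, (opY ^^ n) b])"
      unfolding move by (intro sum.cong) auto
    also have "\<dots> = (\<Sum>i\<le>n. (-1) ^ i * of_nat (n choose i)) * \<Phi> v [a, (opY ^^ n) b]"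
      by (rule sum_distrib_right[symmetric])
    also have "\<dots> = 0 ^ n * \<Phi> v as"
    proof (cases "n = 0")
      case False
      then show ?thesis
        using choose_alternating_sum[of n, where 'a = complex] by (simp add: power_0_left)
    qed (simp add: as)
    finally show ?thesis .
  qed
  \<comment> \<open>The leg acting on V does so through the counit, which leaves i = 0 and the full
    power on the algebra entries.\<close>
  have "(\<Sum>(k1, k2)\<leftarrow>coproduct k. diag_eval k2 as (\<Phi> (coadjoint k1 v))) =
    (\<Sum>n\<le>degree k. \<Sum>i\<le>n. 0 ^ i * (coeff k n * of_nat (n choose i) * diag_eval (monom 1 (n - i)) as (\<Phi> v)))"
  proof -
    have "\<Phi> (coadjoint k1 v) = (\<lambda>bs. counit k1 * \<Phi> v bs)" for k1
      by (simp add: coadjoint_def V fun_eq_iff)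
    then show ?thesis
      by (simp only: sum_coproduct diag_eval_mult counit_monom mult_ac)
  qed
  also have "\<dots> = (\<Sum>n\<le>degree k. 0 ^ n * (coeff k n * \<Phi> v as))"
    by (intro sum.cong refl, unfold sum_bot_power_zero power) simp
  also have "\<dots> = counit k * \<Phi> v as"
    unfolding sum_bot_power_zero by (simp add: counit_def poly_0_coeff_0)
  finally show "(\<Sum>(k1, k2)\<leftarrow>coproduct k. diag_eval k2 as (\<Phi> (coadjoint k1 v))) = counit k * \<Phi> v as" .
qed

text \<open>The trace reads off the coefficient at \<open>id\<close>, whose second derivative
  vanishes.\<close>

lemma tr_delta1: "tr (delta1 a) = 0"
proof -
  have "deriv id = (\<lambda>_. 1::real)"
    by (auto intro!: DERIV_imp_deriv simp: id_def)
  then have "delta1 a id = (\<lambda>_. 0)"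
    by (auto simp: delta1_def)
  then show ?thesis
    by (simp add: tr_def)
qed

lemma coaction_sum: "(\<Sum>(k, w)\<leftarrow>coaction (\<alpha>, \<beta>). F k w) = F 1 (\<alpha>, \<beta>) + F [:0, 1:] (0, \<alpha>)"
  by (simp add: coaction_def)

lemma act_inv_antipode:
  "act (inv_into UNIV antipode 1) a = a"
  "act (inv_into UNIV antipode [:0, 1:]) a = alg_scale (-1) (opY a)"
  unfolding inv_antipode act_antipode_Y by (simp_all add: antipode_def act_1 pcompose_1)

definition phi01 :: cochain where
  "phi01 = (\<lambda>v as. phi0 v as - phi1 v as)"

lemma phi01_eq:
  "phi01 (\<alpha>, \<beta>) as = \<alpha> * tr (as ! 0 \<star> opX (as ! 1)) - \<beta> * tr (as ! 0 \<star> delta1 (as ! 1))"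
  by (simp add: phi01_def phi0_def phi1_def)

lemma phi01_V_scale: "phi01 (V_scale c v) as = c * phi01 v as"
  by (cases v) (simp add: phi01_eq V_scale_def algebra_simps)

lemma crossed_scale:
  assumes "a \<in> crossed_algebra \<Gamma>"
  shows "alg_scale c a \<in> crossed_algebra \<Gamma>"
proof (rule crossed_algebraI)
  show "alg_scale c a \<phi> \<in> test_functions" for \<phi>
    using crossed_algebraD(3)[OF assms, of \<phi>] unfolding test_functions_iff alg_scale_def
    by (auto intro: smooth_on_mult_left)
  show "alg_scale c a \<phi> = (\<lambda>_. 0)" if "\<phi> \<notin> supp a" for \<phi>
    using that by (simp add: alg_scale_def supp_def)
qed (use crossed_algebraD[OF assms] in auto)

context diffeo_group
begin

text \<open>These are the traces of X(ab), \<delta>_1(ab), Y(a X(b)) and Y(a \<delta>_1(b)), in this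
  order. In the last two the trace of the left side equals that of the commutator summand, and the
  rest must add up to 0.\<close>

lemma
  assumes "a \<in> crossed_algebra \<Gamma>" "b \<in> crossed_algebra \<Gamma>"
  shows tr_star_opX: "tr (opX a \<star> b) + tr (a \<star> opX b) + tr (delta1 a \<star> opY b) = 0"
    and tr_star_delta1: "tr (delta1 a \<star> b) + tr (a \<star> delta1 b) = 0"
    and tr_opY_star_opX: "tr (opY a \<star> opX b) = - tr (a \<star> opX (opY b))"
    and tr_opY_star_delta1: "tr (opY a \<star> delta1 b) = - tr (a \<star> delta1 (opY b))"
proof -
  note Cc = assms[THEN crossed_Cc_algebra] assms[THEN crossed_opX, THEN crossed_Cc_algebra]
    assms[THEN crossed_opY, THEN crossed_Cc_algebra] assms[THEN crossed_Cc_algebra, THEN Cc_algebra_delta1]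
    assms[THEN crossed_opY, THEN crossed_opX, THEN crossed_Cc_algebra]
    assms[THEN crossed_opY, THEN crossed_Cc_algebra, THEN Cc_algebra_delta1]
  note fin = Cc[THEN Cc_algebra_finitely_supported]
  note diff = assms[THEN crossed_differentiable] assms[THEN crossed_opX, THEN crossed_differentiable]
  have diff_delta: "differentiable_alg (delta1 b)"
    by (rule differentiable_delta1[OF fin(2) diff(2)])
  have X: "opX (a \<star> b) = alg_add (alg_add (opX a \<star> b) (a \<star> opX b)) (delta1 a \<star> opY b)"
    by (rule opX_star[OF fin(1,2) diff(1,2)])
  \<comment> \<open>Read off from the expanded form, since \<open>crossed_opX\<close> speaks of
    \<open>crossed_algebra\<close> and the product is tracked in \<open>Cc_algebra\<close>.\<close>
  have "opX (a \<star> b) \<in> Cc_algebra \<Gamma>"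
    unfolding X by (intro Cc_algebra_add Cc_algebra_star Cc)
  then have "tr (opX (a \<star> b)) = 0"
    by (intro tr_opX[where \<Gamma> = \<Gamma>] Cc_algebra_star Cc differentiable_star[OF fin(1,2) diff(1,2)])
  moreover have "tr (opX (a \<star> b)) = tr (opX a \<star> b) + tr (a \<star> opX b) + tr (delta1 a \<star> opY b)"
    unfolding X
    by (subst tr_add[of _ \<Gamma>], (intro Cc_algebra_add Cc_algebra_star Cc)+)+ simp
  ultimately show "tr (opX a \<star> b) + tr (a \<star> opX b) + tr (delta1 a \<star> opY b) = 0"
    by simp
  show "tr (delta1 a \<star> b) + tr (a \<star> delta1 b) = 0"
    using tr_delta1[of "a \<star> b"] unfolding delta1_star[OF fin(1,2)]
    by (subst (asm) tr_add[of _ \<Gamma>]) (intro Cc_algebra_star Cc)+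
  have Y1: "opY (a \<star> opX b) = alg_add (opY a \<star> opX b) (alg_add (a \<star> opX (opY b)) (a \<star> opX b))"
    unfolding opY_star[OF fin(1) fin(4) diff(1) diff(4)] opY_opX[OF assms(2)]
    by (simp only: star_add_right[OF fin(1) fin(10) fin(4)])
  have "opY (a \<star> opX b) \<in> Cc_algebra \<Gamma>"
    unfolding Y1 by (intro Cc_algebra_add Cc_algebra_star Cc)
  then have "tr (opY (a \<star> opX b)) = tr (a \<star> opX b)"
    by (intro tr_opY[where \<Gamma> = \<Gamma>] Cc_algebra_star Cc differentiable_star[OF fin(1) fin(4) diff(1) diff(4)])
  moreover have "tr (opY (a \<star> opX b)) = tr (opY a \<star> opX b) + (tr (a \<star> opX (opY b)) + tr (a \<star> opX b))"
    unfolding Y1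
    by (subst tr_add[of _ \<Gamma>], (intro Cc_algebra_add Cc_algebra_star Cc)+)+ simp
  ultimately show "tr (opY a \<star> opX b) = - tr (a \<star> opX (opY b))"
    by (simp add: eq_neg_iff_add_eq_0)
  have Y2: "opY (a \<star> delta1 b) = alg_add (opY a \<star> delta1 b) (alg_add (a \<star> delta1 (opY b)) (a \<star> delta1 b))"
    unfolding opY_star[OF fin(1) fin(8) diff(1) diff_delta] opY_delta1[OF diff(2)]
    by (simp only: star_add_right[OF fin(1) fin(12) fin(8)])
  have "opY (a \<star> delta1 b) \<in> Cc_algebra \<Gamma>"
    unfolding Y2 by (intro Cc_algebra_add Cc_algebra_star Cc)
  then have "tr (opY (a \<star> delta1 b)) = tr (a \<star> delta1 b)"
    by (intro tr_opY[where \<Gamma> = \<Gamma>] Cc_algebra_star Cc differentiable_star[OF fin(1) fin(8) diff(1) diff_delta])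
  moreover have "tr (opY (a \<star> delta1 b)) =
      tr (opY a \<star> delta1 b) + (tr (a \<star> delta1 (opY b)) + tr (a \<star> delta1 b))"
    unfolding Y2
    by (subst tr_add[of _ \<Gamma>], (intro Cc_algebra_add Cc_algebra_star Cc)+)+ simp
  ultimately show "tr (opY a \<star> delta1 b) = - tr (a \<star> delta1 (opY b))"
    by (simp add: eq_neg_iff_add_eq_0)
qed

lemma
  assumes "a \<in> crossed_algebra \<Gamma>" "a' \<in> crossed_algebra \<Gamma>" "b \<in> crossed_algebra \<Gamma>" "b' \<in> crossed_algebra \<Gamma>"
  shows phi01_add_left: "phi01 v [alg_add a a', b] = phi01 v [a, b] + phi01 v [a', b]"
    and phi01_add_right: "phi01 v [a, alg_add b b'] = phi01 v [a, b] + phi01 v [a, b']"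
    and phi01_scale_left: "phi01 v [alg_scale c a, b] = c * phi01 v [a, b]"
    and phi01_scale_right: "phi01 v [a, alg_scale c b] = c * phi01 v [a, b]"
proof -
  note Cc = assms[THEN crossed_Cc_algebra] assms[THEN crossed_opX, THEN crossed_Cc_algebra]
    assms[THEN crossed_Cc_algebra, THEN Cc_algebra_delta1]
  note fin = Cc[THEN Cc_algebra_finitely_supported]
  note diff = assms[THEN crossed_differentiable]
  obtain \<alpha> \<beta> where v: "v = (\<alpha>, \<beta>)"
    by (cases v)
  have tr_add': "tr (alg_add (x \<star> y) (z \<star> w)) = tr (x \<star> y) + tr (z \<star> w)"
    if "x \<in> Cc_algebra \<Gamma>" "y \<in> Cc_algebra \<Gamma>" "z \<in> Cc_algebra \<Gamma>" "w \<in> Cc_algebra \<Gamma>" for x y z w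
    using that by (intro tr_add[where \<Gamma> = \<Gamma>] Cc_algebra_star)
  show "phi01 v [alg_add a a', b] = phi01 v [a, b] + phi01 v [a', b]"
    by (simp add: v phi01_eq star_add_left fin tr_add' Cc algebra_simps)
  show "phi01 v [a, alg_add b b'] = phi01 v [a, b] + phi01 v [a, b']"
    by (simp add: v phi01_eq opX_add diff delta1_add star_add_right fin tr_add' Cc algebra_simps)
  show "phi01 v [alg_scale c a, b] = c * phi01 v [a, b]"
    by (simp add: v phi01_eq star_scale_left fin tr_scale algebra_simps)
  show "phi01 v [a, alg_scale c b] = c * phi01 v [a, b]"
    by (simp add: v phi01_eq opX_scale diff delta1_scale star_scale_right fin tr_scale algebra_simps)
qed

lemma phi01_cochain: "phi01 \<in> cochains \<Gamma> 1"
proof -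
  have "multilinear \<Gamma> 1 phi01"
    unfolding multilinear_def
  proof (intro ballI conjI allI impI)
    fix as v a and i :: nat assume "as \<in> alg_tuples \<Gamma> 1" and i: "i \<le> 1" and a: "a \<in> crossed_algebra \<Gamma>"
    then obtain x y where as: "as = [x, y]" "x \<in> crossed_algebra \<Gamma>" "y \<in> crossed_algebra \<Gamma>"
      by (elim alg_tuples_1E)
    have i: "i = 0 \<or> i = Suc 0"
      using i by auto
    show "phi01 v (as[i := alg_scale c a]) = c * phi01 v (as[i := a])" for c
      using i by (auto simp: as a phi01_scale_left[OF a a as(3,3)] phi01_scale_right[OF as(2,2) a a])
    show "phi01 v (as[i := alg_add a b]) = phi01 v (as[i := a]) + phi01 v (as[i := b])"
      if b: "b \<in> crossed_algebra \<Gamma>" for b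
      using i by (auto simp: as phi01_add_left[OF a b as(3,3)] phi01_add_right[OF as(2,2) a b])
  next
    show "phi01 (v + w) as = phi01 v as + phi01 w as" for v w as
      by (cases v; cases w) (simp add: phi01_eq algebra_simps)
  qed (rule phi01_V_scale)
  moreover have "equivariant \<Gamma> 1 phi01"
  proof (rule equivariant_1I[OF phi01_V_scale])
    fix v a b c d
    assume ab: "a \<in> crossed_algebra \<Gamma>" "b \<in> crossed_algebra \<Gamma>"
    show "phi01 v [alg_scale c a, alg_scale d b] = c * d * phi01 v [a, b]"
      using phi01_scale_left[OF ab(1,1) crossed_scale[OF ab(2)] ab(2)] phi01_scale_right[OF ab(1,1,2,2)]
      by simp
    show "phi01 v [opY a, b] = - phi01 v [a, opY b]"
      by (cases v) (simp add: phi01_eq tr_opY_star_opX[OF ab] tr_opY_star_delta1[OF ab])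
  qed
  ultimately show ?thesis
    by (simp add: cochains_def)
qed

lemma phi01_cyclic: "cyclic \<Gamma> 1 phi01"
  unfolding cyclic_def
proof (intro allI ballI)
  fix v :: V and as assume "as \<in> alg_tuples \<Gamma> 1"
  then obtain a b where as: "as = [a, b]" and ab: "a \<in> crossed_algebra \<Gamma>" "b \<in> crossed_algebra \<Gamma>"
    by (rule alg_tuples_1E)
  obtain \<alpha> \<beta> where v: "v = (\<alpha>, \<beta>)"
    by (cases v)
  note Cc = ab[THEN crossed_Cc_algebra] ab[THEN crossed_opX, THEN crossed_Cc_algebra]
    ab[THEN crossed_opY, THEN crossed_Cc_algebra] ab[THEN crossed_Cc_algebra, THEN Cc_algebra_delta1]
  note fin = Cc[THEN Cc_algebra_finitely_supported]
  have "tr (b \<star> opX a) + tr (a \<star> opX b) + tr (opY b \<star> delta1 a) = 0"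
    using tr_star_opX[OF ab] by (simp add: tr_star_commute Cc)
  then have X: "\<alpha> * tr (b \<star> opX a) + \<alpha> * tr (a \<star> opX b) + \<alpha> * tr (opY b \<star> delta1 a) = 0"
    by (metis distrib_left mult_zero_right)
  have "tr (b \<star> delta1 a) + tr (a \<star> delta1 b) = 0"
    using tr_star_delta1[OF ab] by (simp add: tr_star_commute Cc)
  then have D: "\<beta> * tr (b \<star> delta1 a) + \<beta> * tr (a \<star> delta1 b) = 0"
    by (metis distrib_left mult_zero_right)
  \<comment> \<open>Two signs meet in the last summand: S^-1(Y) = -Y, and the minus in front of
    \<open>phi1\<close>. It therefore enters with a plus, as in X.\<close>
  have "cyclic_op phi01 v as = \<alpha> * tr (b \<star> opX a) - \<beta> * tr (b \<star> delta1 a) + \<alpha> * tr (opY b \<star> delta1 a)"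
    unfolding cyclic_op_def v coaction_sum as act_inv_antipode
    by (simp add: phi01_eq star_scale_left fin tr_scale)
  also have "\<dots> = - (\<alpha> * tr (a \<star> opX b) - \<beta> * tr (a \<star> delta1 b))"
    using X D by algebra
  finally show "cyclic_op phi01 v as = (-1) ^ 1 * phi01 v as"
    by (simp add: phi01_eq v as)
qed

lemma phi01_cocycle: "hochschild_cocycle \<Gamma> 1 phi01"
  unfolding hochschild_cocycle_def
proof (intro conjI phi01_cochain allI ballI)
  fix v :: V and as assume "as \<in> alg_tuples \<Gamma> (1 + 1)"
  then obtain a b c where as: "as = [a, b, c]"
    and abc: "a \<in> crossed_algebra \<Gamma>" "b \<in> crossed_algebra \<Gamma>" "c \<in> crossed_algebra \<Gamma>"
    by (auto simp: alg_tuples_def length_Suc_conv numeral_3_eq_3)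
  obtain \<alpha> \<beta> where v: "v = (\<alpha>, \<beta>)"
    by (cases v)
  note Cc = abc[THEN crossed_Cc_algebra] abc[THEN crossed_opX, THEN crossed_Cc_algebra]
    abc[THEN crossed_opY, THEN crossed_Cc_algebra] abc[THEN crossed_Cc_algebra, THEN Cc_algebra_delta1]
  note fin = Cc[THEN Cc_algebra_finitely_supported]
  note diff = abc[THEN crossed_differentiable]
  have "tr (a \<star> opX (b \<star> c)) =
      tr (a \<star> (opX b \<star> c)) + tr (a \<star> (b \<star> opX c)) + tr (a \<star> (delta1 b \<star> opY c))"
    unfolding opX_star[OF fin(2,3) diff(2,3)]
    by (subst star_add_right star_add_right tr_add[of _ \<Gamma>],
        (intro Cc_algebra_finitely_supported Cc_algebra_add Cc_algebra_star Cc)+)+ simp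
  \<comment> \<open>Here and below the last factor is rotated to the front, where the last face has
    it; the defect term becomes the one with Y(c) a.\<close>
  moreover have "tr (a \<star> (opX b \<star> c)) = tr ((c \<star> a) \<star> opX b)"
    by (simp add: star_assoc[symmetric] fin tr_star_commute[of _ c] Cc Cc_algebra_star)
  moreover have "tr (a \<star> (delta1 b \<star> opY c)) = tr ((opY c \<star> a) \<star> delta1 b)"
    by (simp add: star_assoc[symmetric] fin tr_star_commute[of _ "opY c"] Cc Cc_algebra_star)
  ultimately have X: "tr (a \<star> opX (b \<star> c)) =
      tr ((c \<star> a) \<star> opX b) + tr ((a \<star> b) \<star> opX c) + tr ((opY c \<star> a) \<star> delta1 b)"
    by (simp add: star_assoc fin)
  have "tr (a \<star> delta1 (b \<star> c)) = tr (a \<star> (delta1 b \<star> c)) + tr (a \<star> (b \<star> delta1 c))"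
    unfolding delta1_star[OF fin(2,3)]
    by (subst star_add_right tr_add[of _ \<Gamma>],
        (intro Cc_algebra_finitely_supported Cc_algebra_add Cc_algebra_star Cc)+)+ simp
  moreover have "tr (a \<star> (delta1 b \<star> c)) = tr ((c \<star> a) \<star> delta1 b)"
    by (simp add: star_assoc[symmetric] fin tr_star_commute[of _ c] Cc Cc_algebra_star)
  ultimately have D: "tr (a \<star> delta1 (b \<star> c)) = tr ((c \<star> a) \<star> delta1 b) + tr ((a \<star> b) \<star> delta1 c)"
    by (simp add: star_assoc fin)
  have faces: "hochschild_b 1 phi01 v as = phi01 v [a \<star> b, c] - phi01 v [a, b \<star> c] +
      (phi01 v [c \<star> a, b] + phi01 (0, \<alpha>) [alg_scale (-1) (opY c) \<star> a, b])"
  proof -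
    have "face 1 0 phi01 v as = phi01 v [a \<star> b, c]" "face 1 1 phi01 v as = phi01 v [a, b \<star> c]"
      by (simp_all add: face_def as)
    \<comment> \<open>The index 2 exceeds q = 1, so this is the face with the coaction. Its Y-term
      passes (0, \<alpha>) to the cochain and hence meets \<open>phi1\<close> alone.\<close>
    moreover have "face 1 2 phi01 v as = phi01 v [c \<star> a, b] + phi01 (0, \<alpha>) [alg_scale (-1) (opY c) \<star> a, b]"
      unfolding face_def v coaction_sum as by (simp add: act_inv_antipode)
    moreover have "hochschild_b 1 phi01 v as = face 1 0 phi01 v as - face 1 1 phi01 v as + face 1 2 phi01 v as"
      unfolding hochschild_b_def by (simp add: numeral_2_eq_2)
    ultimately show ?thesis
      by simp
  qed
  show "hochschild_b 1 phi01 v as = 0"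
    unfolding faces unfolding v phi01_eq
    by (simp add: X D star_scale_left fin Cc_algebra_finitely_supported[OF Cc_algebra_star] Cc tr_scale algebra_simps)
qed

end

theorem proposition3p7:
  fixes \<Gamma> :: "(real \<Rightarrow> real) set"
  assumes "discrete_subgroup \<Gamma>"
  shows
   "hochschild_cocycle \<Gamma> 1 (\<lambda>v as. phi0 v as - phi1 v as) \<and>
    cyclic \<Gamma> 1 (\<lambda>v as. phi0 v as - phi1 v as)"
proof -
  interpret diffeo_group \<Gamma>
    using assms by (intro diffeo_group.intro) (simp add: discrete_subgroup_def)
  show ?thesis
    using phi01_cocycle phi01_cyclic by (simp add: phi01_def)
qed

end
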